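(* The category $\mathbb{MNE}$ of MNE-spaces with MNE-morphisms and the category $\mathbb{TW}$ are dually equivalent. Here $\mathbb{TW}$ has as objects pairs $(\mathbf{M},F)$ where $\mathbf{M}=\langle\mathbf{H},\Box,\Diamond\rangle$ is a modal Heyting algebra and $F$ is a Boolean filter of $\mathbf{H}$ such that for all $a,b\in H$, if $a\wedge b=\bot$ and $a\vee b\in F$ then $\Box a\vee\Diamond b\in F$; its morphisms $(\mathbf{M}_1,F_1)\to(\mathbf{M}_2,F_2)$ are modal Heyting algebra homomorphisms $h$ with $h[F_1]\subseteq F_2$.
   Context: A modal Heyting algebra is a Heyting algebra with unary $\Box,\Diamond$ satisfying $\Box a\wedge\Diamond(-a\wedge b)=\bot$, where $-a=a\rightharpoonup\bot$; homomorphisms preserve Heyting operations and $\Box,\Diamond$. A filter is Boolean if it contains every $x$ with $--x=\top$. An Esakia space is a compact ordered space $\langle X,\tau,\le\rangle$ such that if $x\not\le y$ there is a clopen up-set containing $x$ but not $y$, and ${\downarrow}U$ is clopen for every clopen $U$; $\mathcal{U}(X)$, $\mathcal{D}(X)$ denote clopen up-/down-sets. A modal Esakia space is $\langle X,\tau,\le,\eta_1,\eta_2\rangle$ with $\eta_1,\eta_2\colon X\to\mathcal{P}(\mathcal{P}(X))$ such that for all $x$, $U,V\in\mathcal{U}(X)$: $\eta_1(x)\subseteq\mathcal{U}(X)$, $\eta_2(x)\subseteq\mathcal{D}(X)$; $\Box_{\eta_1}(U)=\{x: U\in\eta_1(x)\}$ and $\Diamond_{\eta_2}(U)=\{x: X\setminus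 U\notin\eta_2(x)\}$ are clopen up-sets; if $U\in\eta_1(x)$ then ${\downarrow}U\cup(X\setminus V)\in\eta_2(x)$. An MNE-space is $\langle X,\tau,\le,\eta_1,\eta_2,C\rangle$ with $\langle X,\tau,\le,\eta_1,\eta_2\rangle$ a modal Esakia space and $C$ a closed subset of $\max(X)$ such that for all $U,V\in\mathcal{U}(X)$: if $C\subseteq U\cup V$ and $U\cap V=\emptyset$ then $C\subseteq\Box_{\eta_1}(U)\cup\Diamond_{\eta_2}(V)$. An ME-morphism $f\colon X_1\to X_2$ is a continuous order-preserving map with ${\uparrow}f(x)\subseteq f[{\uparrow}x]$ such that for all $x\in X_1$, $U\in\mathcal{U}(X_2)$: $U\in\eta'_1(f(x))$ iff $f^{-1}[U]\in\eta_1(x)$, and $X_2\setminus U\in\eta'_2(f(x))$ iff $X_1\setminus f^{-1}[U]\in\eta_2(x)$. An MNE-morphism between MNE-spaces with distinguished sets $C_1,C_2$ is an ME-morphism $f$ with $f[C_1]\subseteq C_2$. *)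

theory Defs
  imports
    "HOL-Analysis.Abstract_Topology"
    "HOL-Algebra.Lattice"
    "HOL-Library.Equipollence"
    "HOL-Library.FuncSet"
begin

section \<open>Categories and dual equivalence\<close>

text \<open>
  Hom-sets need not be disjoint, so composition and the arrow part of a functor take the
  objects involved as arguments: \<open>Comp C X Y Z g f\<close> is the composite of
  \<open>f \<in> Hom C X Y\<close> with \<open>g \<in> Hom C Y Z\<close>.
\<close>

record ('o, 'm) cat =
  Obj :: "'o set"
  Hom :: "'o \<Rightarrow> 'o \<Rightarrow> 'm set"
  Comp :: "'o \<Rightarrow> 'o \<Rightarrow> 'o \<Rightarrow> 'm \<Rightarrow> 'm \<Rightarrow> 'm"
  Ident :: "'o \<Rightarrow> 'm"

locale category =
  fixes C :: "('o, 'm) cat"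
  assumes ident_hom: "X \<in> Obj C \<Longrightarrow> Ident C X \<in> Hom C X X"
    and comp_hom: "\<lbrakk>X \<in> Obj C; Y \<in> Obj C; Z \<in> Obj C; f \<in> Hom C X Y; g \<in> Hom C Y Z\<rbrakk>
      \<Longrightarrow> Comp C X Y Z g f \<in> Hom C X Z"
    and comp_ident_right: "\<lbrakk>X \<in> Obj C; Y \<in> Obj C; f \<in> Hom C X Y\<rbrakk>
      \<Longrightarrow> Comp C X X Y f (Ident C X) = f"
    and comp_ident_left: "\<lbrakk>X \<in> Obj C; Y \<in> Obj C; f \<in> Hom C X Y\<rbrakk>
      \<Longrightarrow> Comp C X Y Y (Ident C Y) f = f"
    and comp_assoc: "\<lbrakk>W \<in> Obj C; X \<in> Obj C; Y \<in> Obj C; Z \<in> Obj C;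
        f \<in> Hom C W X; g \<in> Hom C X Y; h \<in> Hom C Y Z\<rbrakk>
      \<Longrightarrow> Comp C W Y Z h (Comp C W X Y g f) = Comp C W X Z (Comp C X Y Z h g) f"

definition op_cat :: "('o, 'm) cat \<Rightarrow> ('o, 'm) cat" where
  "op_cat C = \<lparr>Obj = Obj C, Hom = (\<lambda>X Y. Hom C Y X),
     Comp = (\<lambda>X Y Z g f. Comp C Z Y X f g), Ident = Ident C\<rparr>"

definition full_subcat :: "('o, 'm) cat \<Rightarrow> ('o \<Rightarrow> bool) \<Rightarrow> ('o, 'm) cat" where
  "full_subcat C P = C\<lparr>Obj := {X \<in> Obj C. P X}\<rparr>"

definition is_functor ::
  "('o, 'm) cat \<Rightarrow> ('p, 'n) cat \<Rightarrow> ('o \<Rightarrow> 'p) \<Rightarrow> ('o \<Rightarrow> 'o \<Rightarrow> 'm \<Rightarrow> 'n) \<Rightarrow> bool" where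
  "is_functor C D Fo Fm \<longleftrightarrow>
     (\<forall>X\<in>Obj C. Fo X \<in> Obj D) \<and>
     (\<forall>X\<in>Obj C. \<forall>Y\<in>Obj C. \<forall>f\<in>Hom C X Y. Fm X Y f \<in> Hom D (Fo X) (Fo Y)) \<and>
     (\<forall>X\<in>Obj C. Fm X X (Ident C X) = Ident D (Fo X)) \<and>
     (\<forall>X\<in>Obj C. \<forall>Y\<in>Obj C. \<forall>Z\<in>Obj C. \<forall>f\<in>Hom C X Y. \<forall>g\<in>Hom C Y Z.
        Fm X Z (Comp C X Y Z g f) = Comp D (Fo X) (Fo Y) (Fo Z) (Fm Y Z g) (Fm X Y f))"

definition is_iso :: "('o, 'm) cat \<Rightarrow> 'o \<Rightarrow> 'o \<Rightarrow> 'm \<Rightarrow> bool" where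
  "is_iso C X Y f \<longleftrightarrow> f \<in> Hom C X Y \<and>
     (\<exists>g\<in>Hom C Y X. Comp C X Y X g f = Ident C X \<and> Comp C Y X Y f g = Ident C Y)"

definition is_natural_iso ::
  "('o, 'm) cat \<Rightarrow> ('p, 'n) cat \<Rightarrow> ('o \<Rightarrow> 'p) \<Rightarrow> ('o \<Rightarrow> 'o \<Rightarrow> 'm \<Rightarrow> 'n)
    \<Rightarrow> ('o \<Rightarrow> 'p) \<Rightarrow> ('o \<Rightarrow> 'o \<Rightarrow> 'm \<Rightarrow> 'n) \<Rightarrow> ('o \<Rightarrow> 'n) \<Rightarrow> bool" where
  "is_natural_iso C D Fo Fm Go Gm t \<longleftrightarrow>
     (\<forall>X\<in>Obj C. is_iso D (Fo X) (Go X) (t X)) \<and>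
     (\<forall>X\<in>Obj C. \<forall>Y\<in>Obj C. \<forall>f\<in>Hom C X Y.
        Comp D (Fo X) (Fo Y) (Go Y) (t Y) (Fm X Y f) =
        Comp D (Fo X) (Go X) (Go Y) (Gm X Y f) (t X))"

definition equivalent_cats :: "('o, 'm) cat \<Rightarrow> ('p, 'n) cat \<Rightarrow> bool" where
  "equivalent_cats C D \<longleftrightarrow> category C \<and> category D \<and>
     (\<exists>Fo Fm Go Gm s t.
        is_functor C D Fo Fm \<and> is_functor D C Go Gm \<and>
        is_natural_iso C C (\<lambda>X. X) (\<lambda>X Y f. f)
          (\<lambda>X. Go (Fo X)) (\<lambda>X Y f. Gm (Fo X) (Fo Y) (Fm X Y f)) s \<and>
        is_natural_iso D D (\<lambda>X. X) (\<lambda>X Y f. f)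
          (\<lambda>X. Fo (Go X)) (\<lambda>X Y f. Fm (Go X) (Go Y) (Gm X Y f)) t)"

definition dually_equivalent :: "('o, 'm) cat \<Rightarrow> ('p, 'n) cat \<Rightarrow> bool" where
  "dually_equivalent C D \<longleftrightarrow> equivalent_cats C (op_cat D)"


section \<open>Modal Heyting algebras and the category TW\<close>

record 'a heyting = "'a gorder" +
  imp :: "'a \<Rightarrow> 'a \<Rightarrow> 'a"

locale heyting_algebra = bounded_lattice H for H :: "('a, 'b) heyting_scheme" (structure) +
  assumes imp_closed: "\<lbrakk>x \<in> carrier H; y \<in> carrier H\<rbrakk> \<Longrightarrow> imp H x y \<in> carrier H"
    and residuation: "\<lbrakk>x \<in> carrier H; y \<in> carrier H; z \<in> carrier H\<rbrakk>
      \<Longrightarrow> z \<sqinter> x \<sqsubseteq> y \<longleftrightarrow> z \<sqsubseteq> imp H x y"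

definition neg :: "('a, 'b) heyting_scheme \<Rightarrow> 'a \<Rightarrow> 'a" where
  "neg H x = imp H x \<bottom>\<^bsub>H\<^esub>"

record 'a modal_heyting = "'a heyting" +
  Box :: "'a \<Rightarrow> 'a"
  Dia :: "'a \<Rightarrow> 'a"

locale modal_heyting_algebra =
  heyting_algebra M for M :: "('a, 'b) modal_heyting_scheme" (structure) +
  assumes Box_closed: "x \<in> carrier M \<Longrightarrow> Box M x \<in> carrier M"
    and Dia_closed: "x \<in> carrier M \<Longrightarrow> Dia M x \<in> carrier M"
    and Box_Dia: "\<lbrakk>a \<in> carrier M; b \<in> carrier M\<rbrakk>
      \<Longrightarrow> Box M a \<sqinter> Dia M (neg M a \<sqinter> b) = \<bottom>"

text \<open>Homomorphisms are extensional functions, so that they are determined by their values on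
  the carrier.\<close>

definition modal_heyting_hom :: "'a modal_heyting \<Rightarrow> 'b modal_heyting \<Rightarrow> ('a \<Rightarrow> 'b) set" where
  "modal_heyting_hom M N = {h \<in> carrier M \<rightarrow>\<^sub>E carrier N.
     h \<bottom>\<^bsub>M\<^esub> = \<bottom>\<^bsub>N\<^esub> \<and> h \<top>\<^bsub>M\<^esub> = \<top>\<^bsub>N\<^esub> \<and>
     (\<forall>x\<in>carrier M. \<forall>y\<in>carrier M.
        h (x \<sqinter>\<^bsub>M\<^esub> y) = h x \<sqinter>\<^bsub>N\<^esub> h y \<and>
        h (x \<squnion>\<^bsub>M\<^esub> y) = h x \<squnion>\<^bsub>N\<^esub> h y \<and>
        h (imp M x y) = imp N (h x) (h y)) \<and>
     (\<forall>x\<in>carrier M. h (Box M x) = Box N (h x) \<and> h (Dia M x) = Dia N (h x))}"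

text \<open>Filters may be improper; prime filters are proper.\<close>

definition lattice_filter :: "('a, 'b) gorder_scheme \<Rightarrow> 'a set \<Rightarrow> bool" where
  "lattice_filter L F \<longleftrightarrow> F \<subseteq> carrier L \<and> F \<noteq> {} \<and>
     (\<forall>x\<in>F. \<forall>y\<in>carrier L. x \<sqsubseteq>\<^bsub>L\<^esub> y \<longrightarrow> y \<in> F) \<and>
     (\<forall>x\<in>F. \<forall>y\<in>F. x \<sqinter>\<^bsub>L\<^esub> y \<in> F)"

definition prime_filters :: "('a, 'b) gorder_scheme \<Rightarrow> 'a set set" where
  "prime_filters L = {F. lattice_filter L F \<and> F \<noteq> carrier L \<and>
     (\<forall>x\<in>carrier L. \<forall>y\<in>carrier L. x \<squnion>\<^bsub>L\<^esub> y \<in> F \<longrightarrow> x \<in> F \<or> y \<in> F)}"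

definition boolean_filter :: "('a, 'b) heyting_scheme \<Rightarrow> 'a set \<Rightarrow> bool" where
  "boolean_filter H F \<longleftrightarrow> lattice_filter H F \<and>
     (\<forall>x\<in>carrier H. neg H (neg H x) = \<top>\<^bsub>H\<^esub> \<longrightarrow> x \<in> F)"

definition tw_object :: "'a modal_heyting \<times> 'a set \<Rightarrow> bool" where
  "tw_object = (\<lambda>(M, F). modal_heyting_algebra M \<and> boolean_filter M F \<and>
     (\<forall>a\<in>carrier M. \<forall>b\<in>carrier M.
        a \<sqinter>\<^bsub>M\<^esub> b = \<bottom>\<^bsub>M\<^esub> \<and> a \<squnion>\<^bsub>M\<^esub> b \<in> F \<longrightarrow> Box M a \<squnion>\<^bsub>M\<^esub> Dia M b \<in> F))"

definition tw_hom ::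
  "'a modal_heyting \<times> 'a set \<Rightarrow> 'b modal_heyting \<times> 'b set \<Rightarrow> ('a \<Rightarrow> 'b) set" where
  "tw_hom = (\<lambda>(M, F) (N, G). {h \<in> modal_heyting_hom M N. h ` F \<subseteq> G})"

text \<open>The objects whose carrier belongs to the given collection of sets.\<close>

definition TW :: "'a set set \<Rightarrow> ('a modal_heyting \<times> 'a set, 'a \<Rightarrow> 'a) cat" where
  "TW \<A> = \<lparr>Obj = {A. tw_object A \<and> carrier (fst A) \<in> \<A>}, Hom = tw_hom,
     Comp = (\<lambda>A B C. \<lambda>g f. compose (carrier (fst A)) g f),
     Ident = (\<lambda>A. restrict id (carrier (fst A)))\<rparr>"


section \<open>MNE-spaces\<close>

record 'x ordered_space =
  topol :: "'x topology"
  leq :: "'x rel"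

abbreviation points :: "('x, 'b) ordered_space_scheme \<Rightarrow> 'x set" where
  "points X \<equiv> topspace (topol X)"

definition upset_of :: "('x, 'b) ordered_space_scheme \<Rightarrow> 'x set \<Rightarrow> 'x set" where
  "upset_of X S = leq X `` S"

definition downset_of :: "('x, 'b) ordered_space_scheme \<Rightarrow> 'x set \<Rightarrow> 'x set" where
  "downset_of X S = (leq X)\<inverse> `` S"

definition max_points :: "('x, 'b) ordered_space_scheme \<Rightarrow> 'x set" where
  "max_points X = {x \<in> points X. \<forall>y. (x, y) \<in> leq X \<longrightarrow> y = x}"

definition clopens :: "('x, 'b) ordered_space_scheme \<Rightarrow> 'x set set" where
  "clopens X = {U. openin (topol X) U \<and> closedin (topol X) U}"

definition clopen_upsets :: "('x, 'b) ordered_space_scheme \<Rightarrow> 'x set set" where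
  "clopen_upsets X = {U \<in> clopens X. upset_of X U \<subseteq> U}"

definition clopen_downsets :: "('x, 'b) ordered_space_scheme \<Rightarrow> 'x set set" where
  "clopen_downsets X = {U \<in> clopens X. downset_of X U \<subseteq> U}"

definition esakia_space :: "('x, 'b) ordered_space_scheme \<Rightarrow> bool" where
  "esakia_space X \<longleftrightarrow> compact_space (topol X) \<and> partial_order_on (points X) (leq X) \<and>
     (\<forall>x\<in>points X. \<forall>y\<in>points X. (x, y) \<notin> leq X \<longrightarrow>
        (\<exists>U\<in>clopen_upsets X. x \<in> U \<and> y \<notin> U)) \<and>
     (\<forall>U\<in>clopens X. downset_of X U \<in> clopens X)"

record 'x modal_space = "'x ordered_space" +
  eta1 :: "'x \<Rightarrow> 'x set set"
  eta2 :: "'x \<Rightarrow> 'x set set"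

definition box_eta :: "('x, 'b) modal_space_scheme \<Rightarrow> 'x set \<Rightarrow> 'x set" where
  "box_eta X U = {x \<in> points X. U \<in> eta1 X x}"

definition dia_eta :: "('x, 'b) modal_space_scheme \<Rightarrow> 'x set \<Rightarrow> 'x set" where
  "dia_eta X U = {x \<in> points X. points X - U \<notin> eta2 X x}"

definition modal_esakia_space :: "('x, 'b) modal_space_scheme \<Rightarrow> bool" where
  "modal_esakia_space X \<longleftrightarrow> esakia_space X \<and>
     (\<forall>x\<in>points X. eta1 X x \<subseteq> clopen_upsets X \<and> eta2 X x \<subseteq> clopen_downsets X) \<and>
     (\<forall>U\<in>clopen_upsets X. box_eta X U \<in> clopen_upsets X \<and> dia_eta X U \<in> clopen_upsets X) \<and>
     (\<forall>x\<in>points X. \<forall>U\<in>clopen_upsets X. \<forall>V\<in>clopen_upsets X.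
        U \<in> eta1 X x \<longrightarrow> downset_of X U \<union> (points X - V) \<in> eta2 X x)"

record 'x mne_space = "'x modal_space" +
  distinguished :: "'x set"

definition mne_object :: "'x mne_space \<Rightarrow> bool" where
  "mne_object X \<longleftrightarrow> modal_esakia_space X \<and>
     closedin (topol X) (distinguished X) \<and> distinguished X \<subseteq> max_points X \<and>
     (\<forall>U\<in>clopen_upsets X. \<forall>V\<in>clopen_upsets X.
        distinguished X \<subseteq> U \<union> V \<and> U \<inter> V = {} \<longrightarrow>
        distinguished X \<subseteq> box_eta X U \<union> dia_eta X V)"

definition preimage ::
  "('x, 'b) ordered_space_scheme \<Rightarrow> ('x \<Rightarrow> 'y) \<Rightarrow> 'y set \<Rightarrow> 'x set" where
  "preimage X f U = f -` U \<inter> points X"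

definition me_morphism ::
  "('x, 'b) modal_space_scheme \<Rightarrow> ('y, 'c) modal_space_scheme \<Rightarrow> ('x \<Rightarrow> 'y) set" where
  "me_morphism X Y = {f \<in> extensional (points X).
     continuous_map (topol X) (topol Y) f \<and>
     (\<forall>x y. (x, y) \<in> leq X \<longrightarrow> (f x, f y) \<in> leq Y) \<and>
     (\<forall>x\<in>points X. upset_of Y {f x} \<subseteq> f ` upset_of X {x}) \<and>
     (\<forall>x\<in>points X. \<forall>U\<in>clopen_upsets Y.
        (U \<in> eta1 Y (f x) \<longleftrightarrow> preimage X f U \<in> eta1 X x) \<and>
        (points Y - U \<in> eta2 Y (f x) \<longleftrightarrow> points X - preimage X f U \<in> eta2 X x))}"

definition mne_morphism :: "'x mne_space \<Rightarrow> 'y mne_space \<Rightarrow> ('x \<Rightarrow> 'y) set" where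
  "mne_morphism X Y = {f \<in> me_morphism X Y. f ` distinguished X \<subseteq> distinguished Y}"

definition MNE :: "'x set set \<Rightarrow> ('x mne_space, 'x \<Rightarrow> 'x) cat" where
  "MNE \<X> = \<lparr>Obj = {X. mne_object X \<and> points X \<in> \<X>}, Hom = mne_morphism,
     Comp = (\<lambda>X Y Z. \<lambda>g f. compose (points X) g f),
     Ident = (\<lambda>X. restrict id (points X))\<rparr>"


section \<open>Size\<close>

text \<open>
  The type of all objects of a category bounds their cardinality, whereas the dual of an
  infinite object may have the cardinality of its power set.  The collections \<open>\<A>\<close> and \<open>\<X>\<close>
  play the part of Grothendieck universes of admissible carriers; when they are closed under
  subsets of power sets up to bijection (\<open>powers_in\<close> both ways), no object is excluded for
  reasons of size.  In general the objects to consider are those whose dual is admissible, too: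
  an algebra is \<open>spectrally_small\<close> if its set of prime filters is in bijection with an
  admissible carrier of spaces, and a space is \<open>clopen_small\<close> if its set of clopen up-sets
  is in bijection with an admissible carrier of algebras.  The first condition holds for all
  algebras with carriers in \<open>\<A>\<close> if \<open>powers_in \<A> \<X>\<close>, e.g. if \<open>\<X>\<close> consists of all
  subsets of a type \<open>'a set\<close> and \<open>\<A>\<close> of all subsets of \<open>'a\<close>; the second one for all
  spaces with carriers in \<open>\<X>\<close> if \<open>powers_in \<X> \<A>\<close>.
\<close>

definition powers_in :: "'a set set \<Rightarrow> 'b set set \<Rightarrow> bool" where
  "powers_in \<A> \<X> \<longleftrightarrow> (\<forall>A\<in>\<A>. \<forall>S. S \<subseteq> Pow A \<longrightarrow> (\<exists>X\<in>\<X>. S \<approx> X))"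

definition clopen_small :: "'a set set \<Rightarrow> 'x mne_space \<Rightarrow> bool" where
  "clopen_small \<A> X \<longleftrightarrow> (\<exists>A\<in>\<A>. clopen_upsets X \<approx> A)"

definition spectrally_small :: "'x set set \<Rightarrow> 'a modal_heyting \<times> 'a set \<Rightarrow> bool" where
  "spectrally_small \<X> = (\<lambda>(M, F). \<exists>X\<in>\<X>. prime_filters M \<approx> X)"

lemma clopen_small_if_powers_in:
  assumes "powers_in \<X> \<A>" and "X \<in> Obj (MNE \<X>)"
  shows "clopen_small \<A> X"
proof -
  have "clopen_upsets X \<subseteq> Pow (points X)"
    unfolding clopen_upsets_def clopens_def using openin_subset by fastforce
  moreover have "points X \<in> \<X>"
    using assms(2) by (simp add: MNE_def)
  ultimately show ?thesis
    using assms(1) unfolding powers_in_def clopen_small_def by blast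
qed

lemma spectrally_small_if_powers_in:
  assumes "powers_in \<A> \<X>" and "A \<in> Obj (TW \<A>)"
  shows "spectrally_small \<X> A"
proof -
  obtain M F where A: "A = (M, F)" by (cases A)
  have "prime_filters M \<subseteq> Pow (carrier M)"
    unfolding prime_filters_def lattice_filter_def by blast
  moreover have "carrier M \<in> \<A>"
    using assms(2) A by (simp add: TW_def)
  ultimately show ?thesis
    using assms(1) A unfolding powers_in_def spectrally_small_def by auto
qed

end

theory Submission
  imports Defs "HOL-Analysis.Function_Topology"
begin

text \<open>
  The proof is Esakia duality, in a form that also disposes of the size questions.  A space \<open>X\<close>
  and an algebra \<open>(M, F)\<close> are dual via \<open>\<phi>\<close> if \<open>\<phi>\<close> is an order isomorphism from \<open>M\<close> onto the
  clopen up-sets of \<open>X\<close> that carries the modal operators to \<open>\<box>\<^sub>\<eta>\<close>, \<open>\<diamond>\<^sub>\<eta>\<close> and \<open>F\<close> to the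
  clopen up-sets that contain the distinguished set.  A space has a dual algebra on every carrier
  in bijection with its clopen up-sets, and an algebra has a dual space on every carrier in
  bijection with its prime filters.  Between two dual pairs, the equation
  \<open>\<phi> (h b) = f\<^sup>-\<^sup>1(\<psi> b)\<close> is a bijective correspondence of morphisms, compatible with composition.
  Such a correspondence yields an equivalence by choosing a dual for every object.

  Filters containing the dense elements correspond to closed sets of maximal points because a
  prime filter containing all \<open>x \<squnion> neg H x\<close> is maximal.
\<close>

section \<open>Equivalences from correspondences of morphisms\<close>

text \<open>Prescribed carriers are the obstacle. The clopen up-sets of a space are sets of points,
  while its dual has to live on an admissible set of another type, and no bijection between the two
  is canonical. Hence the witness \<open>\<phi>\<close> is part of the data, and functors appear
  only after choices; these do no harm because arrows correspond uniquely once the witnesses are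
  fixed. Both categories play symmetric parts, so one argument gives both directions.

  If \<open>a\<close>, \<open>b\<close> represent \<open>U\<close>, \<open>V\<close>, the complement
  of the set of \<open>neg M a \<sqinter> b\<close> is the down-set of \<open>U\<close> together
  with the complement of \<open>V\<close>: the condition linking \<open>eta1\<close> and
  \<open>eta2\<close> is the modal identity. A dense clopen up-set contains every maximal point,
  since each point lies below one of its members. Conversely, \<open>x \<squnion> neg H x\<close> is
  dense; if a prime filter P contains all these elements and Q extends P, an element a of Q outside
  P would give neg a in P and bottom in Q. A closed set of maximal points is the intersection of the
  clopen up-sets around it, and a filter is the intersection of the prime filters above it, so the
  set and the filter determine each other.\<close>

locale dual_correspondence = C: category C + D: category D
  for C :: "('o, 'm) cat" and D :: "('p, 'n) cat" +
  fixes T :: "'t set" and L :: "'t \<Rightarrow> 'o" and R :: "'t \<Rightarrow> 'p"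
    and Q :: "'t \<Rightarrow> 't \<Rightarrow> 'm \<Rightarrow> 'n \<Rightarrow> bool"
  assumes L_obj: "t \<in> T \<Longrightarrow> L t \<in> Obj C"
    and R_obj: "t \<in> T \<Longrightarrow> R t \<in> Obj D"
    and L_surj: "X \<in> Obj C \<Longrightarrow> \<exists>t\<in>T. L t = X"
    and R_surj: "A \<in> Obj D \<Longrightarrow> \<exists>t\<in>T. R t = A"
    and Q_total: "\<lbrakk>s \<in> T; t \<in> T; f \<in> Hom C (L s) (L t)\<rbrakk> \<Longrightarrow> \<exists>h\<in>Hom D (R s) (R t). Q s t f h"
    and Q_surj: "\<lbrakk>s \<in> T; t \<in> T; h \<in> Hom D (R s) (R t)\<rbrakk> \<Longrightarrow> \<exists>f\<in>Hom C (L s) (L t). Q s t f h"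
    and Q_fun: "\<lbrakk>s \<in> T; t \<in> T; f \<in> Hom C (L s) (L t); h \<in> Hom D (R s) (R t);
        h' \<in> Hom D (R s) (R t); Q s t f h; Q s t f h'\<rbrakk> \<Longrightarrow> h = h'"
    and Q_inj: "\<lbrakk>s \<in> T; t \<in> T; f \<in> Hom C (L s) (L t); f' \<in> Hom C (L s) (L t);
        h \<in> Hom D (R s) (R t); Q s t f h; Q s t f' h\<rbrakk> \<Longrightarrow> f = f'"
    and Q_ident: "t \<in> T \<Longrightarrow> Q t t (Ident C (L t)) (Ident D (R t))"
    and Q_comp: "\<lbrakk>s \<in> T; t \<in> T; u \<in> T; f \<in> Hom C (L s) (L t); g \<in> Hom C (L t) (L u);
        h \<in> Hom D (R s) (R t); k \<in> Hom D (R t) (R u); Q s t f h; Q t u g k\<rbrakk>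
      \<Longrightarrow> Q s u (Comp C (L s) (L t) (L u) g f) (Comp D (R s) (R t) (R u) k h)"
begin

text \<open>A whole triple is chosen, not only a dual object: \<open>Q\<close> depends on the
  witness stored in the triple, so all arrows at \<open>X\<close> must be compared through the same
  one.\<close>

definition lift_obj :: "'o \<Rightarrow> 't" where
  "lift_obj X = (SOME t. t \<in> T \<and> L t = X)"

definition to_obj :: "'o \<Rightarrow> 'p" where
  "to_obj X = R (lift_obj X)"

definition to_hom :: "'o \<Rightarrow> 'o \<Rightarrow> 'm \<Rightarrow> 'n" where
  "to_hom X Y f = (SOME h. h \<in> Hom D (to_obj X) (to_obj Y) \<and> Q (lift_obj X) (lift_obj Y) f h)"

lemma lift_obj:
  assumes "X \<in> Obj C"
  shows "lift_obj X \<in> T" "L (lift_obj X) = X"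
  unfolding lift_obj_def using someI_ex[of "\<lambda>t. t \<in> T \<and> L t = X"] L_surj[OF assms] by auto

lemma to_obj: "X \<in> Obj C \<Longrightarrow> to_obj X \<in> Obj D"
  unfolding to_obj_def by (simp add: R_obj lift_obj)

lemma to_hom:
  assumes "X \<in> Obj C" "Y \<in> Obj C" "f \<in> Hom C X Y"
  shows "to_hom X Y f \<in> Hom D (to_obj X) (to_obj Y)" "Q (lift_obj X) (lift_obj Y) f (to_hom X Y f)"
proof -
  have "\<exists>h. h \<in> Hom D (to_obj X) (to_obj Y) \<and> Q (lift_obj X) (lift_obj Y) f h"
    using Q_total[of "lift_obj X" "lift_obj Y" f] assms by (auto simp: lift_obj to_obj_def)
  from someI_ex[OF this]
  show "to_hom X Y f \<in> Hom D (to_obj X) (to_obj Y)" "Q (lift_obj X) (lift_obj Y) f (to_hom X Y f)"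
    unfolding to_hom_def by auto
qed

text \<open>Both sides of each functor law are related by \<open>Q\<close> to the same arrow, so
  \<open>Q_fun\<close> identifies them whatever was chosen.\<close>

lemma is_functor_to: "is_functor C D to_obj to_hom"
proof -
  have id: "to_hom X X (Ident C X) = Ident D (to_obj X)" if "X \<in> Obj C" for X
    using that Q_fun[of "lift_obj X" "lift_obj X" "Ident C X"] to_hom[of X X "Ident C X"]
      Q_ident[of "lift_obj X"] C.ident_hom[of X] D.ident_hom[of "to_obj X"] to_obj[of X]
    by (simp add: lift_obj to_obj_def)
  have comp: "to_hom X Z (Comp C X Y Z g f)
      = Comp D (to_obj X) (to_obj Y) (to_obj Z) (to_hom Y Z g) (to_hom X Y f)"
    if o: "X \<in> Obj C" "Y \<in> Obj C" "Z \<in> Obj C" and f: "f \<in> Hom C X Y" and g: "g \<in> Hom C Y Z"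
    for X Y Z f g
  proof (rule Q_fun)
    show "lift_obj X \<in> T" "lift_obj Z \<in> T"
      using o lift_obj by auto
    have gf: "Comp C X Y Z g f \<in> Hom C X Z"
      using o f g C.comp_hom by blast
    then show "Comp C X Y Z g f \<in> Hom C (L (lift_obj X)) (L (lift_obj Z))"
      using o by (simp add: lift_obj)
    show "to_hom X Z (Comp C X Y Z g f) \<in> Hom D (R (lift_obj X)) (R (lift_obj Z))"
      "Q (lift_obj X) (lift_obj Z) (Comp C X Y Z g f) (to_hom X Z (Comp C X Y Z g f))"
      using to_hom[OF _ _ gf] o by (auto simp: to_obj_def)
    show "Comp D (to_obj X) (to_obj Y) (to_obj Z) (to_hom Y Z g) (to_hom X Y f)
        \<in> Hom D (R (lift_obj X)) (R (lift_obj Z))"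
      using D.comp_hom[OF to_obj to_obj to_obj] to_hom o f g by (simp add: to_obj_def)
    show "Q (lift_obj X) (lift_obj Z) (Comp C X Y Z g f)
        (Comp D (to_obj X) (to_obj Y) (to_obj Z) (to_hom Y Z g) (to_hom X Y f))"
      using Q_comp[of "lift_obj X" "lift_obj Y" "lift_obj Z" f g "to_hom X Y f" "to_hom Y Z g"]
        to_hom o f g by (simp add: lift_obj to_obj_def)
  qed
  show ?thesis
    unfolding is_functor_def using to_obj to_hom id comp by blast
qed

text \<open>Exchanging the categories only permutes the assumptions: totality with surjectivity,
  uniqueness with injectivity. This yields the backward functor.\<close>

lemma swap: "dual_correspondence D C T R L (\<lambda>s t h f. Q s t f h)"
proof (unfold_locales, goal_cases)
  case (1 t) then show ?case by (rule R_obj)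
next
  case (2 t) then show ?case by (rule L_obj)
next
  case (3 X) then show ?case by (rule R_surj)
next
  case (4 A) then show ?case by (rule L_surj)
next
  case (5 s t f) then show ?case by (rule Q_surj)
next
  case (6 s t h) then show ?case by (rule Q_total)
next
  case (7 s t f h h') then show ?case using Q_inj by blast
next
  case (8 s t f f' h) then show ?case using Q_fun by blast
next
  case (9 t) then show ?case by (rule Q_ident)
next
  case (10 s t u f g h k) then show ?case using Q_comp by blast
qed

definition from_obj :: "'p \<Rightarrow> 'o" where
  "from_obj = dual_correspondence.to_obj T R L"

definition from_hom :: "'p \<Rightarrow> 'p \<Rightarrow> 'n \<Rightarrow> 'm" where
  "from_hom = dual_correspondence.to_hom C T R L (\<lambda>s t h f. Q s t f h)"

definition unit :: "'o \<Rightarrow> 'm" where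
  "unit X = (SOME f. f \<in> Hom C X (from_obj (to_obj X)) \<and>
     Q (lift_obj X) (dual_correspondence.lift_obj T R (to_obj X)) f (Ident D (to_obj X)))"

text \<open>The component of the unit at an object is the arrow that corresponds to the identity of its
  image, hence an isomorphism.\<close>

lemma unit_natural_iso:
  "is_natural_iso C C (\<lambda>X. X) (\<lambda>X Y f. f)
     (\<lambda>X. from_obj (to_obj X)) (\<lambda>X Y f. from_hom (to_obj X) (to_obj Y) (to_hom X Y f)) unit"
proof -
  interpret S: dual_correspondence D C T R L "\<lambda>s t h f. Q s t f h"
    by (rule swap)
  \<comment> \<open>The triple chosen for \<open>to_obj X\<close> as an object of \<open>D\<close>
    may differ from the one chosen for \<open>X\<close>. They share the object of \<open>D\<close>,
    but their objects of \<open>C\<close> may differ; the unit compares these.\<close>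
  define v where "v X = S.lift_obj (to_obj X)" for X
  have v: "v X \<in> T" "R (v X) = to_obj X" "L (v X) = from_obj (to_obj X)"
    "from_obj (to_obj X) \<in> Obj C" if "X \<in> Obj C" for X
    using that S.lift_obj[OF to_obj] S.to_obj[OF to_obj]
    by (auto simp: v_def from_obj_def S.to_obj_def)
  have R_lift: "R (lift_obj X) = to_obj X" for X
    by (simp add: to_obj_def)
  note [simp] = v lift_obj R_lift to_obj
  have unit: "unit X \<in> Hom C X (from_obj (to_obj X))"
    "Q (lift_obj X) (v X) (unit X) (Ident D (to_obj X))" if X: "X \<in> Obj C" for X
  proof -
    have "\<exists>f\<in>Hom C (L (lift_obj X)) (L (v X)). Q (lift_obj X) (v X) f (Ident D (to_obj X))"
      by (rule Q_surj) (use X D.ident_hom in auto)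
    then have "\<exists>f. f \<in> Hom C X (from_obj (to_obj X)) \<and> Q (lift_obj X) (v X) f (Ident D (to_obj X))"
      using X by auto
    from someI_ex[OF this] show "unit X \<in> Hom C X (from_obj (to_obj X))"
      "Q (lift_obj X) (v X) (unit X) (Ident D (to_obj X))"
      unfolding unit_def v_def[symmetric] by auto
  qed
  have iso: "is_iso C X (from_obj (to_obj X)) (unit X)" if X: "X \<in> Obj C" for X
  proof -
    let ?i = "Ident D (to_obj X)" and ?Y = "from_obj (to_obj X)"
    have i: "?i \<in> Hom D (to_obj X) (to_obj X)" "Comp D (to_obj X) (to_obj X) (to_obj X) ?i ?i = ?i"
      using X D.ident_hom D.comp_ident_left by auto
    have "\<exists>g\<in>Hom C (L (v X)) (L (lift_obj X)). Q (v X) (lift_obj X) g ?i"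
      by (rule Q_surj) (use X i in auto)
    then obtain g where g: "g \<in> Hom C ?Y X" "Q (v X) (lift_obj X) g ?i"
      using X by auto
    have "Comp C X ?Y X g (unit X) = Ident C X"
      using Q_inj[of "lift_obj X" "lift_obj X" "Comp C X ?Y X g (unit X)" "Ident C X" ?i]
        Q_comp[of "lift_obj X" "v X" "lift_obj X" "unit X" g ?i ?i] Q_ident[of "lift_obj X"]
        X g i unit[OF X] C.ident_hom[of X] C.comp_hom[of X ?Y X "unit X" g]
      by simp
    moreover have "Comp C ?Y X ?Y (unit X) g = Ident C ?Y"
      using Q_inj[of "v X" "v X" "Comp C ?Y X ?Y (unit X) g" "Ident C ?Y" ?i]
        Q_comp[of "v X" "lift_obj X" "v X" g "unit X" ?i ?i] Q_ident[of "v X"]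
        X g i unit[OF X] C.ident_hom[of ?Y] C.comp_hom[of ?Y X ?Y g "unit X"]
      by simp
    ultimately show ?thesis
      unfolding is_iso_def using unit(1)[OF X] g(1) by blast
  qed
  have nat: "Comp C X Y (from_obj (to_obj Y)) (unit Y) f =
      Comp C X (from_obj (to_obj X)) (from_obj (to_obj Y))
        (from_hom (to_obj X) (to_obj Y) (to_hom X Y f)) (unit X)"
    if X: "X \<in> Obj C" and Y: "Y \<in> Obj C" and f: "f \<in> Hom C X Y" for X Y f
  proof -
    let ?h = "to_hom X Y f" and ?X = "from_obj (to_obj X)" and ?Y = "from_obj (to_obj Y)"
    let ?k = "from_hom (to_obj X) (to_obj Y) ?h"
    note h = to_hom[OF X Y f]
    have k: "?k \<in> Hom C ?X ?Y" "Q (v X) (v Y) ?k ?h"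
      using S.to_hom[OF to_obj[OF X] to_obj[OF Y] h(1)]
      by (simp_all add: from_hom_def from_obj_def v_def)
    have i: "Ident D (to_obj X) \<in> Hom D (to_obj X) (to_obj X)"
      "Ident D (to_obj Y) \<in> Hom D (to_obj Y) (to_obj Y)"
      "Comp D (to_obj X) (to_obj Y) (to_obj Y) (Ident D (to_obj Y)) ?h = ?h"
      "Comp D (to_obj X) (to_obj X) (to_obj Y) ?h (Ident D (to_obj X)) = ?h"
      using X Y h D.ident_hom D.comp_ident_left D.comp_ident_right by auto
    \<comment> \<open>Both paths around the naturality square correspond to \<open>?h\<close>
      composed with an identity, so injectivity of \<open>Q\<close> makes them equal.\<close>
    have "Q (lift_obj X) (v Y) (Comp C X Y ?Y (unit Y) f) ?h"
      using Q_comp[of "lift_obj X" "lift_obj Y" "v Y" f "unit Y" ?h "Ident D (to_obj Y)"]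
        X Y f h i unit[OF Y] by simp
    moreover have "Q (lift_obj X) (v Y) (Comp C X ?X ?Y ?k (unit X)) ?h"
      using Q_comp[of "lift_obj X" "v X" "v Y" "unit X" ?k "Ident D (to_obj X)" ?h]
        X Y k h i unit[OF X] by simp
    ultimately show ?thesis
      using Q_inj[of "lift_obj X" "v Y" "Comp C X Y ?Y (unit Y) f" "Comp C X ?X ?Y ?k (unit X)" ?h]
        X Y f h k unit C.comp_hom[of X Y ?Y f "unit Y"] C.comp_hom[of X ?X ?Y "unit X" ?k]
      by simp
  qed
  show ?thesis
    unfolding is_natural_iso_def using iso nat by blast
qed

lemma equivalent_cats: "equivalent_cats C D"
proof -
  interpret S: dual_correspondence D C T R L "\<lambda>s t h f. Q s t f h"
    by (rule swap)
  have from_eq: "from_obj = S.to_obj" "from_hom = S.to_hom"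
    by (simp_all add: from_obj_def from_hom_def)
  \<comment> \<open>Exchanging twice restores the original correspondence, so the unit of the
    exchanged one is the second natural isomorphism.\<close>
  have to_eq: "S.from_obj = to_obj" "S.from_hom = to_hom"
    by (simp_all add: S.from_obj_def S.from_hom_def)
  show ?thesis
    unfolding equivalent_cats_def
    using is_functor_to S.is_functor_to unit_natural_iso S.unit_natural_iso
      C.category_axioms D.category_axioms
    unfolding from_eq to_eq by blast
qed

end

section \<open>Prime filters of Heyting algebras\<close>

lemma (in lattice) meet_mono:
  assumes "a \<in> carrier L" "b \<in> carrier L" "c \<in> carrier L" "d \<in> carrier L" "a \<sqsubseteq> b" "c \<sqsubseteq> d"
  shows "a \<sqinter> c \<sqsubseteq> b \<sqinter> d"
proof (rule meet_le)
  show "a \<sqinter> c \<sqsubseteq> b"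
    using le_trans[OF meet_left \<open>a \<sqsubseteq> b\<close>] assms by simp
  show "a \<sqinter> c \<sqsubseteq> d"
    using le_trans[OF meet_right \<open>c \<sqsubseteq> d\<close>] assms by simp
qed (use assms in auto)

context heyting_algebra
begin

lemma neg_closed: "x \<in> carrier H \<Longrightarrow> neg H x \<in> carrier H"
  by (simp add: neg_def imp_closed)

lemma imp_mp:
  assumes "x \<in> carrier H" "y \<in> carrier H"
  shows "imp H x y \<sqinter> x \<sqsubseteq> y"
  using residuation[OF assms imp_closed[OF assms]] imp_closed[OF assms] by simp

lemma meet_neg: "x \<in> carrier H \<Longrightarrow> x \<sqinter> neg H x = \<bottom>"
  using imp_mp[of x "\<bottom>"] neg_closed[of x] meet_comm[of H x]
  by (intro le_antisym) (auto simp: neg_def)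

text \<open>By residuation, meeting with \<open>e\<close> is a left adjoint and preserves joins.
  This is the distributivity behind the prime filter theorem.\<close>

lemma meet_join_le:
  assumes "x \<in> carrier H" "y \<in> carrier H" "e \<in> carrier H" "k \<in> carrier H"
    and "e \<sqinter> x \<sqsubseteq> k" "e \<sqinter> y \<sqsubseteq> k"
  shows "e \<sqinter> (x \<squnion> y) \<sqsubseteq> k"
proof -
  have "x \<sqsubseteq> imp H e k" "y \<sqsubseteq> imp H e k"
    using assms residuation meet_comm[of H e] by metis+
  then have "x \<squnion> y \<sqsubseteq> imp H e k"
    using assms by (intro join_le imp_closed)
  then show ?thesis
    using assms residuation[of e k "x \<squnion> y"] meet_comm[of H e] by simp
qed

text \<open>The negation of \<open>x \<squnion> neg H x\<close> lies below both
  \<open>neg H x\<close> and its negation, hence below bottom. Boolean filters therefore contain all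
  instances of excluded middle.\<close>

lemma neg_neg_excluded_middle:
  assumes "x \<in> carrier H"
  shows "neg H (neg H (x \<squnion> neg H x)) = \<top>"
proof -
  define n where "n = neg H (x \<squnion> neg H x)"
  have c: "neg H x \<in> carrier H" "x \<squnion> neg H x \<in> carrier H" "n \<in> carrier H"
    using assms by (auto simp: n_def neg_closed)
  have n0: "n \<sqinter> (x \<squnion> neg H x) = \<bottom>"
    using meet_neg[OF c(2)] by (simp add: n_def meet_comm)
  have "n \<sqinter> x \<sqsubseteq> n \<sqinter> (x \<squnion> neg H x)" "n \<sqinter> neg H x \<sqsubseteq> n \<sqinter> (x \<squnion> neg H x)"
    using assms c by (auto intro!: meet_mono join_left join_right)
  then have "n \<sqsubseteq> neg H x" "n \<sqsubseteq> neg H (neg H x)"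
    using assms c n0 residuation[of x "\<bottom>" n] residuation[of "neg H x" "\<bottom>" n]
    by (simp_all add: neg_def)
  then have "n \<sqsubseteq> neg H x \<sqinter> neg H (neg H x)"
    using c by (intro meet_le) (auto simp: neg_closed)
  then have "n \<sqsubseteq> \<bottom>"
    using meet_neg[OF c(1)] by simp
  then have "\<top> \<sqinter> n \<sqsubseteq> \<bottom>"
    using c le_trans[OF meet_right[of "\<top>" n]] by simp
  then have "\<top> \<sqsubseteq> neg H n"
    using c residuation[of n "\<bottom>" "\<top>"] by (simp add: neg_def)
  then show ?thesis
    using c neg_closed[of n] unfolding n_def by (intro le_antisym) auto
qed

end

section \<open>Filters and prime filters in bounded lattices\<close>

lemma lattice_filterD:
  assumes "lattice_filter L F"
  shows "F \<subseteq> carrier L" "F \<noteq> {}"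
    "\<And>x y. \<lbrakk>x \<in> F; y \<in> carrier L; x \<sqsubseteq>\<^bsub>L\<^esub> y\<rbrakk> \<Longrightarrow> y \<in> F"
    "\<And>x y. \<lbrakk>x \<in> F; y \<in> F\<rbrakk> \<Longrightarrow> x \<sqinter>\<^bsub>L\<^esub> y \<in> F"
  using assms by (auto simp: lattice_filter_def)

lemma prime_filtersD:
  assumes "F \<in> prime_filters L"
  shows "lattice_filter L F" "F \<noteq> carrier L"
    "\<And>x y. \<lbrakk>x \<in> carrier L; y \<in> carrier L; x \<squnion>\<^bsub>L\<^esub> y \<in> F\<rbrakk> \<Longrightarrow> x \<in> F \<or> y \<in> F"
  using assms by (auto simp: prime_filters_def)

context bounded_lattice
begin

lemma filter_top: "lattice_filter L F \<Longrightarrow> \<top> \<in> F"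
  by (metis ex_in_conv lattice_filterD subset_iff top_closed top_higher)

lemma filter_meet_iff:
  assumes F: "lattice_filter L F" and x: "x \<in> carrier L" and y: "y \<in> carrier L"
  shows "x \<sqinter> y \<in> F \<longleftrightarrow> x \<in> F \<and> y \<in> F"
proof
  assume "x \<sqinter> y \<in> F"
  then show "x \<in> F \<and> y \<in> F"
    using lattice_filterD(3)[OF F _ x meet_left[OF x y]] lattice_filterD(3)[OF F _ y meet_right[OF x y]]
    by simp
qed (simp add: lattice_filterD(4)[OF F])

lemma prime_filter_bottom:
  assumes F: "F \<in> prime_filters L"
  shows "\<bottom> \<notin> F"
proof
  assume "\<bottom> \<in> F"
  then have "carrier L \<subseteq> F"
    using lattice_filterD(3)[OF prime_filtersD(1)[OF F]] bottom_lower by blast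
  then show False
    using lattice_filterD(1)[OF prime_filtersD(1)[OF F]] prime_filtersD(2)[OF F] by simp
qed

lemma prime_filter_join_iff:
  assumes F: "F \<in> prime_filters L" and x: "x \<in> carrier L" and y: "y \<in> carrier L"
  shows "x \<squnion> y \<in> F \<longleftrightarrow> x \<in> F \<or> y \<in> F"
proof
  assume "x \<squnion> y \<in> F"
  then show "x \<in> F \<or> y \<in> F"
    using prime_filtersD(3)[OF F x y] by simp
next
  assume "x \<in> F \<or> y \<in> F"
  then show "x \<squnion> y \<in> F"
    using lattice_filterD(3)[OF prime_filtersD(1)[OF F] _ join_closed[OF x y]]
      join_left[OF x y] join_right[OF x y] by metis
qed

text \<open>This is the filter generated by \<open>F\<close> and \<open>x\<close>. Closure of
  \<open>F\<close> under meets lets one \<open>c\<close> stand for finitely many elements.\<close>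

lemma filter_adjoin:
  assumes F: "lattice_filter L F" and x: "x \<in> carrier L"
  shows "lattice_filter L {z \<in> carrier L. \<exists>c\<in>F. c \<sqinter> x \<sqsubseteq> z}" (is "lattice_filter L ?G")
    and "insert x F \<subseteq> {z \<in> carrier L. \<exists>c\<in>F. c \<sqinter> x \<sqsubseteq> z}"
proof -
  note FD = lattice_filterD[OF F]
  show sub: "insert x F \<subseteq> ?G"
  proof
    fix z assume "z \<in> insert x F"
    then show "z \<in> ?G"
    proof
      assume "z = x"
      then show ?thesis
        using x filter_top[OF F] meet_right[of "\<top>" x] by auto
    next
      assume "z \<in> F"
      then show ?thesis
        using x FD(1) meet_left[of z x] by (auto intro!: bexI[of _ z])
    qed
  qed
  have "y \<in> ?G" if z: "z \<in> ?G" and y: "y \<in> carrier L" "z \<sqsubseteq> y" for z y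
  proof -
    obtain c where c: "c \<in> F" "c \<sqinter> x \<sqsubseteq> z" "z \<in> carrier L" "c \<in> carrier L"
      using z FD(1) by blast
    then have "c \<sqinter> x \<sqsubseteq> y"
      using x y le_trans[of "c \<sqinter> x" z y] by simp
    then show ?thesis
      using c y by blast
  qed
  moreover have "y \<sqinter> z \<in> ?G" if yz: "y \<in> ?G" "z \<in> ?G" for y z
  proof -
    obtain c d where cd: "c \<in> F" "d \<in> F" "c \<sqinter> x \<sqsubseteq> y" "d \<sqinter> x \<sqsubseteq> z"
      using yz by blast
    have c: "c \<in> carrier L" "d \<in> carrier L" "y \<in> carrier L" "z \<in> carrier L"
      using cd FD(1) yz by auto
    have "(c \<sqinter> d) \<sqinter> x \<sqsubseteq> c \<sqinter> x" "(c \<sqinter> d) \<sqinter> x \<sqsubseteq> d \<sqinter> x"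
      using c x by (auto intro!: meet_mono meet_left meet_right)
    then have "(c \<sqinter> d) \<sqinter> x \<sqsubseteq> y" "(c \<sqinter> d) \<sqinter> x \<sqsubseteq> z"
      using c x cd le_trans[of "(c \<sqinter> d) \<sqinter> x" "c \<sqinter> x" y] le_trans[of "(c \<sqinter> d) \<sqinter> x" "d \<sqinter> x" z]
      by auto
    then have "(c \<sqinter> d) \<sqinter> x \<sqsubseteq> y \<sqinter> z"
      using c x by (intro meet_le) auto
    then show ?thesis
      using FD(4)[OF cd(1,2)] c by auto
  qed
  ultimately show "lattice_filter L ?G"
    using sub unfolding lattice_filter_def by (intro conjI ballI impI) auto
qed

end

text \<open>A filter maximal among those disjoint from \<open>I\<close> is prime: two elements
  outside it with join inside it would force a join of two elements of \<open>I\<close> into it.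
  Asking \<open>I\<close> only to be closed under joins lets a singleton serve as
  \<open>I\<close>.\<close>

theorem (in heyting_algebra) prime_filter_theorem:
  assumes F: "lattice_filter H F" and I: "I \<subseteq> carrier H" "I \<noteq> {}" "F \<inter> I = {}"
    and join: "\<And>x y. \<lbrakk>x \<in> I; y \<in> I\<rbrakk> \<Longrightarrow> x \<squnion> y \<in> I"
  obtains P where "P \<in> prime_filters H" "F \<subseteq> P" "P \<inter> I = {}"
proof -
  define \<F> where "\<F> = {G. lattice_filter H G \<and> F \<subseteq> G \<and> G \<inter> I = {}}"
  have "\<exists>P\<in>\<F>. \<forall>G\<in>\<F>. P \<subseteq> G \<longrightarrow> G = P"
  proof (rule subset_Zorn_nonempty)
    show "\<F> \<noteq> {}"
      using F I by (auto simp: \<F>_def)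
    fix \<C> assume "\<C> \<noteq> {}" and chain: "subset.chain \<F> \<C>"
    then have *: "lattice_filter H G \<and> F \<subseteq> G \<and> G \<inter> I = {}" if "G \<in> \<C>" for G
      using that by (auto simp: subset_chain_def \<F>_def)
    have "lattice_filter H (\<Union>\<C>)"
      unfolding lattice_filter_def
    proof (intro conjI ballI impI)
      show "\<Union>\<C> \<subseteq> carrier H"
        using * lattice_filterD(1)[of H] by (intro Union_least) blast
      obtain G where "G \<in> \<C>"
        using \<open>\<C> \<noteq> {}\<close> by auto
      then show "\<Union>\<C> \<noteq> {}"
        using * lattice_filterD(2)[of H G] by auto
    next
      fix x y assume "x \<in> \<Union>\<C>" "y \<in> carrier H" "x \<sqsubseteq> y"
      then obtain G where "G \<in> \<C>" "x \<in> G" by auto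
      then show "y \<in> \<Union>\<C>"
        using lattice_filterD(3)[of H G x y] * \<open>y \<in> carrier H\<close> \<open>x \<sqsubseteq> y\<close> by auto
    next
      fix x y assume "x \<in> \<Union>\<C>" "y \<in> \<Union>\<C>"
      then obtain G1 G2 where G12: "G1 \<in> \<C>" "x \<in> G1" "G2 \<in> \<C>" "y \<in> G2" by auto
      then have "G1 \<subseteq> G2 \<or> G2 \<subseteq> G1"
        using chain by (simp add: subset_chain_def)
      then obtain G where "G \<in> \<C>" "x \<in> G" "y \<in> G"
        using G12 by auto
      then show "x \<sqinter> y \<in> \<Union>\<C>"
        using lattice_filterD(4)[of H G x y] * by auto
    qed
    then show "\<Union>\<C> \<in> \<F>"
      using * \<open>\<C> \<noteq> {}\<close> by (auto simp: \<F>_def)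
  qed
  then obtain P where P: "lattice_filter H P" "F \<subseteq> P" "P \<inter> I = {}"
    and max: "\<And>G. \<lbrakk>lattice_filter H G; P \<subseteq> G; G \<inter> I = {}\<rbrakk> \<Longrightarrow> G = P"
    unfolding \<F>_def by auto
  \<comment> \<open>By maximality, the filter generated by \<open>P\<close> and \<open>x\<close>
    must meet \<open>I\<close>.\<close>
  have meets: "\<exists>c\<in>P. \<exists>i\<in>I. c \<sqinter> x \<sqsubseteq> i" if x: "x \<in> carrier H" "x \<notin> P" for x
  proof (rule ccontr)
    let ?G = "{z \<in> carrier H. \<exists>c\<in>P. c \<sqinter> x \<sqsubseteq> z}"
    assume "\<not> ?thesis"
    then have "?G \<inter> I = {}" by auto
    then show False
      using max[OF filter_adjoin(1)[OF P(1) x(1)]] filter_adjoin(2)[OF P(1) x(1)] x by auto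
  qed
  have "x \<in> P \<or> y \<in> P" if xy: "x \<in> carrier H" "y \<in> carrier H" "x \<squnion> y \<in> P" for x y
  proof (rule ccontr)
    assume "\<not> ?thesis"
    then obtain c d i j where cd: "c \<in> P" "d \<in> P" "i \<in> I" "j \<in> I"
      "c \<sqinter> x \<sqsubseteq> i" "d \<sqinter> y \<sqsubseteq> j"
      using meets[of x] meets[of y] xy by auto
    \<comment> \<open>A common element of \<open>P\<close> that serves for both \<open>x\<close> and
      \<open>y\<close>, as distributivity requires.\<close>
    define e where "e = c \<sqinter> d"
    have c: "c \<in> carrier H" "d \<in> carrier H" "i \<in> carrier H" "j \<in> carrier H" "e \<in> carrier H"
      using cd I(1) lattice_filterD(1)[OF P(1)] meet_closed by (auto simp: e_def subset_iff)
    have "e \<sqinter> x \<sqsubseteq> c \<sqinter> x" "e \<sqinter> y \<sqsubseteq> d \<sqinter> y"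
      using c xy by (auto simp: e_def intro!: meet_mono meet_left meet_right)
    moreover have "c \<sqinter> x \<sqsubseteq> i \<squnion> j" "d \<sqinter> y \<sqsubseteq> i \<squnion> j"
      using cd c xy le_trans[OF cd(5) join_left[of i j]] le_trans[OF cd(6) join_right[of i j]] by auto
    ultimately have "e \<sqinter> x \<sqsubseteq> i \<squnion> j" "e \<sqinter> y \<sqsubseteq> i \<squnion> j"
      using c xy le_trans[of "e \<sqinter> x" "c \<sqinter> x" "i \<squnion> j"] le_trans[of "e \<sqinter> y" "d \<sqinter> y" "i \<squnion> j"]
      by auto
    then have "e \<sqinter> (x \<squnion> y) \<sqsubseteq> i \<squnion> j"
      using c xy by (intro meet_join_le) auto
    moreover have "e \<sqinter> (x \<squnion> y) \<in> P"
      using lattice_filterD(4)[OF P(1)] cd xy by (simp add: e_def)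
    ultimately have "i \<squnion> j \<in> P"
      using lattice_filterD(3)[OF P(1)] c by simp
    then show False
      using join[of i j] cd P(3) by auto
  qed
  moreover have "P \<noteq> carrier H"
    using P(3) I by blast
  ultimately have "P \<in> prime_filters H"
    using P(1) by (auto simp: prime_filters_def)
  then show ?thesis
    using P that by blast
qed

corollary (in heyting_algebra) prime_filter_separation:
  assumes "lattice_filter H F" "b \<in> carrier H" "b \<notin> F"
  obtains P where "P \<in> prime_filters H" "F \<subseteq> P" "b \<notin> P"
proof -
  have "b \<squnion> b = b"
    using assms by (intro le_antisym join_le join_left) auto
  then show ?thesis
    using prime_filter_theorem[of F "{b}"] assms that by auto
qed

section \<open>Compactness\<close>

text \<open>A directed family bounds each of its finite subfamilies, so compactness yields one
  member in place of a finite subcover.\<close>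

lemma compactin_directed_cover:
  assumes K: "compactin T K" and op: "\<And>U. U \<in> \<U> \<Longrightarrow> openin T U" and cov: "K \<subseteq> \<Union>\<U>"
    and ne: "\<U> \<noteq> {}" and dir: "\<And>U V. \<lbrakk>U \<in> \<U>; V \<in> \<U>\<rbrakk> \<Longrightarrow> \<exists>W\<in>\<U>. U \<union> V \<subseteq> W"
  shows "\<exists>U\<in>\<U>. K \<subseteq> U"
proof -
  obtain \<F> where \<F>: "finite \<F>" "\<F> \<subseteq> \<U>" "K \<subseteq> \<Union>\<F>"
    using K op cov unfolding compactin_def by meson
  have "\<exists>U\<in>\<U>. \<Union>\<F> \<subseteq> U"
    using \<F>(1,2)
  proof (induction \<F>)
    case empty
    then show ?case using ne by auto
  next
    case (insert V \<F>)
    then obtain U where "U \<in> \<U>" "\<Union>\<F> \<subseteq> U" by auto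
    moreover obtain W where "W \<in> \<U>" "V \<union> U \<subseteq> W"
      using dir insert.prems \<open>U \<in> \<U>\<close> by blast
    ultimately show ?case by auto
  qed
  then show ?thesis using \<F>(3) by blast
qed

text \<open>This covers the clopen up-sets of an Esakia space and also the sets
  \<open>repr a\<close> of a spectrum, before these are known to be all of its clopen
  up-sets.\<close>

locale clopen_lattice =
  fixes T :: "'x topology" and \<L> :: "'x set set"
  assumes clopen: "U \<in> \<L> \<Longrightarrow> openin T U \<and> closedin T U"
    and empty: "{} \<in> \<L>" and whole: "topspace T \<in> \<L>"
    and Int: "\<lbrakk>U \<in> \<L>; V \<in> \<L>\<rbrakk> \<Longrightarrow> U \<inter> V \<in> \<L>"
    and Un: "\<lbrakk>U \<in> \<L>; V \<in> \<L>\<rbrakk> \<Longrightarrow> U \<union> V \<in> \<L>"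
begin

lemma separate_compact_point:
  assumes K: "compactin T K" and sep: "\<And>x. x \<in> K \<Longrightarrow> \<exists>U\<in>\<L>. x \<in> U \<and> y \<notin> U"
  shows "\<exists>U\<in>\<L>. K \<subseteq> U \<and> y \<notin> U"
proof -
  have "\<exists>U\<in>{U \<in> \<L>. y \<notin> U}. K \<subseteq> U"
  proof (rule compactin_directed_cover[OF K])
    show "\<exists>W\<in>{U \<in> \<L>. y \<notin> U}. U \<union> V \<subseteq> W" if "U \<in> {U \<in> \<L>. y \<notin> U}" "V \<in> {U \<in> \<L>. y \<notin> U}" for U V
      using that Un[of U V] by blast
    show "K \<subseteq> \<Union>{U \<in> \<L>. y \<notin> U}"
      using sep by blast
  qed (use clopen empty in auto)
  then show ?thesis by blast
qed

text \<open>Compactness is used twice: for \<open>K\<close> against a single point of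
  \<open>J\<close>, and for \<open>J\<close> against the complements of the sets so obtained. The
  separating set always contains the point of \<open>K\<close>, so the direction of an order
  survives.\<close>

lemma separate_compact:
  assumes K: "compactin T K" and J: "compactin T J"
    and sep: "\<And>x y. \<lbrakk>x \<in> K; y \<in> J\<rbrakk> \<Longrightarrow> \<exists>U\<in>\<L>. x \<in> U \<and> y \<notin> U"
  shows "\<exists>U\<in>\<L>. K \<subseteq> U \<and> J \<inter> U = {}"
proof -
  let ?\<U> = "{topspace T - U | U. U \<in> \<L> \<and> K \<subseteq> U}"
  have "\<exists>W\<in>?\<U>. J \<subseteq> W"
  proof (rule compactin_directed_cover[OF J])
    show "J \<subseteq> \<Union>?\<U>"
    proof
      fix y assume y: "y \<in> J"
      obtain U where "U \<in> \<L>" "K \<subseteq> U" "y \<notin> U"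
        using separate_compact_point[OF K sep[OF _ y]] by blast
      then show "y \<in> \<Union>?\<U>"
        using compactin_subset_topspace[OF J] y by (intro UnionI[of "topspace T - U"]) auto
    qed
    show "openin T W" if "W \<in> ?\<U>" for W
      using that clopen by auto
    show "?\<U> \<noteq> {}"
      using whole compactin_subset_topspace[OF K] by blast
    fix W W' assume "W \<in> ?\<U>" "W' \<in> ?\<U>"
    then obtain U U' where "U \<in> \<L>" "K \<subseteq> U" "W = topspace T - U"
      "U' \<in> \<L>" "K \<subseteq> U'" "W' = topspace T - U'" by blast
    then show "\<exists>W''\<in>?\<U>. W \<union> W' \<subseteq> W''"
      using Int[of U U'] by (intro bexI[of _ "topspace T - (U \<inter> U')"]) auto
  qed
  then show ?thesis by blast
qed

text \<open>Here it is not known which of the two points the separating set contains, so a member of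
  the lattice alone need not do. The cover consists of the complements of the sets
  \<open>U - V\<close> around \<open>y\<close>, and is directed because these are closed under
  intersection.\<close>

lemma separate_point_compact:
  assumes K: "compactin T K" and y: "y \<in> topspace T"
    and sep: "\<And>x. x \<in> K \<Longrightarrow> \<exists>U\<in>\<L>. (x \<in> U) \<noteq> (y \<in> U)"
  shows "\<exists>U\<in>\<L>. \<exists>V\<in>\<L>. y \<in> U - V \<and> K \<inter> (U - V) = {}"
proof -
  let ?\<U> = "{V \<union> (topspace T - U) | U V. U \<in> \<L> \<and> V \<in> \<L> \<and> y \<in> U \<and> y \<notin> V}"
  have "\<exists>W\<in>?\<U>. K \<subseteq> W"
  proof (rule compactin_directed_cover[OF K])
    show "K \<subseteq> \<Union>?\<U>"
    proof
      fix x assume x: "x \<in> K"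
      then obtain U where U: "U \<in> \<L>" "(x \<in> U) \<noteq> (y \<in> U)"
        using sep by blast
      show "x \<in> \<Union>?\<U>"
      proof (cases "x \<in> U")
        case True
        \<comment> \<open>A set containing \<open>x\<close> but not \<open>y\<close> takes the place
          of \<open>V\<close>, paired with the whole space; in the other case it takes the place of
          \<open>U\<close>, paired with the empty set.\<close>
        then have "U \<union> (topspace T - topspace T) \<in> ?\<U>"
          using U y whole True by blast
        then show ?thesis by (rule UnionI) (use True in auto)
      next
        case False
        then have "{} \<union> (topspace T - U) \<in> ?\<U>"
          using U empty False by blast
        then show ?thesis by (rule UnionI) (use False x compactin_subset_topspace[OF K] in auto)
      qed
    qed
    show "openin T W" if "W \<in> ?\<U>" for W
      using that clopen by auto
    show "?\<U> \<noteq> {}"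
      using whole empty y by blast
    fix W W' assume "W \<in> ?\<U>" "W' \<in> ?\<U>"
    then obtain U V U' V' where *: "U \<in> \<L>" "V \<in> \<L>" "y \<in> U" "y \<notin> V" "W = V \<union> (topspace T - U)"
      "U' \<in> \<L>" "V' \<in> \<L>" "y \<in> U'" "y \<notin> V'" "W' = V' \<union> (topspace T - U')" by blast
    then show "\<exists>W''\<in>?\<U>. W \<union> W' \<subseteq> W''"
      using Int[of U U'] Un[of V V']
      by (intro bexI[of _ "(V \<union> V') \<union> (topspace T - (U \<inter> U'))"]) blast+
  qed
  then obtain U V where "U \<in> \<L>" "V \<in> \<L>" "y \<in> U" "y \<notin> V" "K \<subseteq> V \<union> (topspace T - U)"
    by blast
  then show ?thesis by blast
qed

text \<open>Separate \<open>y\<close> from the complement of \<open>W\<close>, which is compact. So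
  differences of members form a base as soon as the members distinguish points.\<close>

lemma basis:
  assumes "compact_space T" and sep: "\<And>x y. \<lbrakk>x \<in> topspace T; y \<in> topspace T; x \<noteq> y\<rbrakk>
      \<Longrightarrow> \<exists>U\<in>\<L>. (x \<in> U) \<noteq> (y \<in> U)"
    and W: "openin T W" "y \<in> W"
  shows "\<exists>U\<in>\<L>. \<exists>V\<in>\<L>. y \<in> U - V \<and> U - V \<subseteq> W"
proof -
  have "compactin T (topspace T - W)"
    using assms(1) W(1) by (intro closedin_compact_space) auto
  moreover have y: "y \<in> topspace T"
    using W openin_subset by blast
  moreover have "\<exists>U\<in>\<L>. (x \<in> U) \<noteq> (y \<in> U)" if "x \<in> topspace T - W" for x
    using that W(2) y by (intro sep) auto
  ultimately obtain U V where UV: "U \<in> \<L>" "V \<in> \<L>" "y \<in> U - V" "(topspace T - W) \<inter> (U - V) = {}"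
    using separate_point_compact[of "topspace T - W" y] by auto
  then have "U - V \<subseteq> W"
    using clopen[OF UV(1)] openin_subset[of T U] by blast
  then show ?thesis
    using UV by blast
qed

end

section \<open>Esakia spaces\<close>

lemma clopen_upsetsI:
  assumes "openin (topol X) U" "closedin (topol X) U" "\<And>x y. \<lbrakk>x \<in> U; (x, y) \<in> leq X\<rbrakk> \<Longrightarrow> y \<in> U"
  shows "U \<in> clopen_upsets X"
  using assms by (auto simp: clopen_upsets_def clopens_def upset_of_def)

lemma clopen_upsetsD:
  assumes "U \<in> clopen_upsets X"
  shows "openin (topol X) U" "closedin (topol X) U" "U \<subseteq> points X"
    "\<And>x y. \<lbrakk>x \<in> U; (x, y) \<in> leq X\<rbrakk> \<Longrightarrow> y \<in> U"
  using assms openin_subset by (auto simp: clopen_upsets_def clopens_def upset_of_def)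

locale esakia =
  fixes X :: "('x, 'b) ordered_space_scheme"
  assumes esakia: "esakia_space X"
begin

lemma compact: "compact_space (topol X)"
  and leq_points: "(x, y) \<in> leq X \<Longrightarrow> x \<in> points X \<and> y \<in> points X"
  and leq_refl: "x \<in> points X \<Longrightarrow> (x, x) \<in> leq X"
  and leq_trans: "\<lbrakk>(x, y) \<in> leq X; (y, z) \<in> leq X\<rbrakk> \<Longrightarrow> (x, z) \<in> leq X"
  and leq_antisym: "\<lbrakk>(x, y) \<in> leq X; (y, x) \<in> leq X\<rbrakk> \<Longrightarrow> x = y"
  and separation: "\<lbrakk>x \<in> points X; y \<in> points X; (x, y) \<notin> leq X\<rbrakk>
    \<Longrightarrow> \<exists>U\<in>clopen_upsets X. x \<in> U \<and> y \<notin> U"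
  and clopen_downset_of: "U \<in> clopens X \<Longrightarrow> downset_of X U \<in> clopens X"
  using esakia
  by (auto simp: esakia_space_def partial_order_on_def preorder_on_def refl_on_def
      dest: transD antisymD)

sublocale clopen_lattice "topol X" "clopen_upsets X"
proof
  fix U V assume U: "U \<in> clopen_upsets X" and V: "V \<in> clopen_upsets X"
  show "U \<inter> V \<in> clopen_upsets X"
    using clopen_upsetsD[OF U] clopen_upsetsD[OF V] by (intro clopen_upsetsI) auto
  show "U \<union> V \<in> clopen_upsets X"
    using clopen_upsetsD[OF U] clopen_upsetsD[OF V] by (intro clopen_upsetsI) auto
qed (auto intro: clopen_upsetsI simp: clopen_upsetsD leq_points)

lemma point_separation:
  assumes "x \<in> points X" "y \<in> points X" "x \<noteq> y"
  shows "\<exists>U\<in>clopen_upsets X. (x \<in> U) \<noteq> (y \<in> U)"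
proof (cases "(x, y) \<in> leq X")
  case True
  then have "(y, x) \<notin> leq X"
    using assms(3) leq_antisym by blast
  then show ?thesis
    using separation[OF assms(2,1)] by auto
next
  case False
  then show ?thesis
    using separation[OF assms(1,2)] by auto
qed

lemma point_eqI:
  "\<lbrakk>x \<in> points X; y \<in> points X; \<And>U. U \<in> clopen_upsets X \<Longrightarrow> x \<in> U \<longleftrightarrow> y \<in> U\<rbrakk> \<Longrightarrow> x = y"
  using point_separation by blast

lemma leqI:
  "\<lbrakk>x \<in> points X; y \<in> points X; \<And>U. \<lbrakk>U \<in> clopen_upsets X; x \<in> U\<rbrakk> \<Longrightarrow> y \<in> U\<rbrakk> \<Longrightarrow> (x, y) \<in> leq X"
  using separation by blast

text \<open>Order separation presents the principal up-set as the intersection of the clopen up-sets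
  containing \<open>x\<close>. Its compactness is what the back condition for dual maps
  needs.\<close>

lemma closedin_upset_of:
  assumes "x \<in> points X"
  shows "closedin (topol X) (upset_of X {x})"
proof -
  have "upset_of X {x} = \<Inter>{U \<in> clopen_upsets X. x \<in> U}"
  proof
    show "upset_of X {x} \<subseteq> \<Inter>{U \<in> clopen_upsets X. x \<in> U}"
      using clopen_upsetsD(4) by (auto simp: upset_of_def)
    show "\<Inter>{U \<in> clopen_upsets X. x \<in> U} \<subseteq> upset_of X {x}"
    proof
      fix y assume y: "y \<in> \<Inter>{U \<in> clopen_upsets X. x \<in> U}"
      then have "y \<in> points X"
        using whole assms by auto
      then show "y \<in> upset_of X {x}"
        using y assms leqI[of x y] by (auto simp: upset_of_def)
    qed
  qed
  moreover have "closedin (topol X) (\<Inter>{U \<in> clopen_upsets X. x \<in> U})"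
    using whole assms by (intro closedin_Inter) (auto simp: clopen_upsetsD(2))
  ultimately show ?thesis by simp
qed

text \<open>This is the Heyting implication of up-sets; it is clopen because down-sets of clopen
  sets are.\<close>

lemma clopen_upset_imp:
  assumes U: "U \<in> clopen_upsets X" and V: "V \<in> clopen_upsets X"
  shows "points X - downset_of X (U - V) \<in> clopen_upsets X"
proof -
  have "U - V \<in> clopens X"
    using clopen_upsetsD[OF U] clopen_upsetsD[OF V] by (auto simp: clopens_def)
  then have "downset_of X (U - V) \<in> clopens X"
    by (rule clopen_downset_of)
  then show ?thesis
    by (intro clopen_upsetsI)
      (auto simp: clopens_def downset_of_def leq_points dest: leq_trans)
qed

text \<open>An up-set \<open>W\<close> meets the down-set of \<open>U - V\<close> exactly if it
  meets \<open>U - V\<close> itself.\<close>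

lemma clopen_upset_residuation:
  assumes W: "W \<in> clopen_upsets X"
  shows "W \<inter> U \<subseteq> V \<longleftrightarrow> W \<subseteq> points X - downset_of X (U - V)"
proof
  assume "W \<inter> U \<subseteq> V"
  then show "W \<subseteq> points X - downset_of X (U - V)"
    using clopen_upsetsD(3,4)[OF W] by (auto simp: downset_of_def)
next
  assume *: "W \<subseteq> points X - downset_of X (U - V)"
  then show "W \<inter> U \<subseteq> V"
    using clopen_upsetsD(3)[OF W] by (fastforce simp: downset_of_def dest: leq_refl)
qed

text \<open>A point outside a set of maximal points is not above any of its elements, so the order
  separation applies.\<close>

lemma closed_max_separation:
  assumes C: "closedin (topol X) C" "C \<subseteq> max_points X" and y: "y \<in> points X" "y \<notin> C"
  shows "\<exists>U\<in>clopen_upsets X. C \<subseteq> U \<and> y \<notin> U"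
proof (rule separate_compact_point)
  show "compactin (topol X) C"
    using C(1) compact by (rule closedin_compact_space[rotated])
  fix z assume z: "z \<in> C"
  then have "z \<in> points X" "(z, y) \<notin> leq X"
    using C(2) y by (auto simp: max_points_def)
  then show "\<exists>U\<in>clopen_upsets X. z \<in> U \<and> y \<notin> U"
    using separation y by blast
qed

end

section \<open>Duality between a space and an algebra\<close>

text \<open>Only the order is transported: it determines all lattice operations. The algebra need
  not be known to be Heyting, so the locale also serves while one is being constructed.\<close>

locale clopen_representation = bounded_lattice L + clopen_lattice T \<L>
  for L :: "('a, 'b) gorder_scheme" (structure) and T :: "'x topology" and \<L> +
  fixes \<phi> :: "'a \<Rightarrow> 'x set"
  assumes bij: "bij_betw \<phi> (carrier L) \<L>"
    and le_iff: "\<lbrakk>a \<in> carrier L; b \<in> carrier L\<rbrakk> \<Longrightarrow> a \<sqsubseteq> b \<longleftrightarrow> \<phi> a \<subseteq> \<phi> b"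
begin

lemma repr_closed: "a \<in> carrier L \<Longrightarrow> \<phi> a \<in> \<L>"
  using bij by (auto simp: bij_betw_def)

lemma repr_points: "\<lbrakk>a \<in> carrier L; x \<in> \<phi> a\<rbrakk> \<Longrightarrow> x \<in> topspace T"
  using repr_closed clopen openin_subset by blast

lemma repr_surj: "U \<in> \<L> \<Longrightarrow> \<exists>a\<in>carrier L. \<phi> a = U"
  using bij by (auto simp: bij_betw_def)

lemma repr_eq_iff: "\<lbrakk>a \<in> carrier L; b \<in> carrier L\<rbrakk> \<Longrightarrow> \<phi> a = \<phi> b \<longleftrightarrow> a = b"
  using bij by (auto simp: bij_betw_def inj_on_def)

text \<open>Surjectivity provides an element representing the intersection; being a lower bound of
  \<open>a\<close> and \<open>b\<close>, it lies below their meet.\<close>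

lemma repr_meet:
  assumes a: "a \<in> carrier L" and b: "b \<in> carrier L"
  shows "\<phi> (a \<sqinter> b) = \<phi> a \<inter> \<phi> b"
proof
  show "\<phi> (a \<sqinter> b) \<subseteq> \<phi> a \<inter> \<phi> b"
    using a b le_iff[of "a \<sqinter> b" a] le_iff[of "a \<sqinter> b" b] meet_left[OF a b] meet_right[OF a b]
    by simp
  obtain c where c: "c \<in> carrier L" "\<phi> c = \<phi> a \<inter> \<phi> b"
    using repr_surj Int repr_closed a b by metis
  then have "c \<sqsubseteq> a \<sqinter> b"
    using a b le_iff by (intro meet_le) auto
  then show "\<phi> a \<inter> \<phi> b \<subseteq> \<phi> (a \<sqinter> b)"
    using c a b le_iff by simp
qed

lemma repr_join:
  assumes a: "a \<in> carrier L" and b: "b \<in> carrier L"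
  shows "\<phi> (a \<squnion> b) = \<phi> a \<union> \<phi> b"
proof
  show "\<phi> a \<union> \<phi> b \<subseteq> \<phi> (a \<squnion> b)"
    using a b le_iff[of a "a \<squnion> b"] le_iff[of b "a \<squnion> b"] join_left[OF a b] join_right[OF a b]
    by simp
  obtain c where c: "c \<in> carrier L" "\<phi> c = \<phi> a \<union> \<phi> b"
    using repr_surj Un repr_closed a b by metis
  then have "a \<squnion> b \<sqsubseteq> c"
    using a b le_iff by (intro join_le) auto
  then show "\<phi> (a \<squnion> b) \<subseteq> \<phi> a \<union> \<phi> b"
    using c a b le_iff by simp
qed

lemma repr_bottom: "\<phi> \<bottom> = {}"
proof -
  obtain c where "c \<in> carrier L" "\<phi> c = {}"
    using repr_surj empty by blast
  then show ?thesis
    using le_iff[of "\<bottom>" c] by auto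
qed

lemma repr_top: "\<phi> \<top> = topspace T"
proof -
  obtain c where "c \<in> carrier L" "\<phi> c = topspace T"
    using repr_surj whole by blast
  then show ?thesis
    using le_iff[of c "\<top>"] repr_points[of "\<top>"] by auto
qed

lemma repr_filter:
  assumes "C \<subseteq> topspace T"
  shows "lattice_filter L {a \<in> carrier L. C \<subseteq> \<phi> a}"
  unfolding lattice_filter_def
proof (intro conjI ballI impI)
  have "\<top> \<in> {a \<in> carrier L. C \<subseteq> \<phi> a}"
    using assms repr_top by simp
  then show "{a \<in> carrier L. C \<subseteq> \<phi> a} \<noteq> {}" by blast
qed (auto simp: repr_meet le_iff)

text \<open>If no point had the filter \<open>P\<close>, the sets \<open>\<phi> b \<union> (topspace T - \<phi> a)\<close> with \<open>a \<in> P\<close> and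
  \<open>b \<notin> P\<close> would form a directed open cover.\<close>

lemma prime_filter_point:
  assumes T: "compact_space T" and P: "P \<in> prime_filters L"
  shows "\<exists>x\<in>topspace T. P = {a \<in> carrier L. x \<in> \<phi> a}"
proof (rule ccontr)
  assume none: "\<not> ?thesis"
  note PD = lattice_filterD[OF prime_filtersD(1)[OF P]]
  let ?\<U> = "{\<phi> b \<union> (topspace T - \<phi> a) | a b. a \<in> P \<and> b \<in> carrier L - P}"
  have "\<exists>W\<in>?\<U>. topspace T \<subseteq> W"
  proof (rule compactin_directed_cover)
    show "compactin T (topspace T)"
      using T by (simp add: compact_space_def)
    show "openin T W" if "W \<in> ?\<U>" for W
      using that clopen repr_closed PD(1) by blast
    have tb: "\<top> \<in> P" "\<bottom> \<in> carrier L - P"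
      using filter_top[OF prime_filtersD(1)[OF P]] prime_filter_bottom[OF P] by auto
    then show "?\<U> \<noteq> {}" by blast
    show "topspace T \<subseteq> \<Union>?\<U>"
    proof
      fix x assume x: "x \<in> topspace T"
      then obtain c where c: "c \<in> carrier L" "(c \<in> P) \<noteq> (x \<in> \<phi> c)"
        using none PD(1) by blast
      show "x \<in> \<Union>?\<U>"
      proof (cases "c \<in> P")
        case True
        then have "\<phi> \<bottom> \<union> (topspace T - \<phi> c) \<in> ?\<U>"
          using tb by blast
        then show ?thesis
          by (rule UnionI) (use True c x in auto)
      next
        case False
        then have "\<phi> c \<union> (topspace T - \<phi> \<top>) \<in> ?\<U>"
          using tb c by blast
        then show ?thesis
          by (rule UnionI) (use False c in auto)
      qed
    qed
    fix W W' assume "W \<in> ?\<U>" "W' \<in> ?\<U>"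
    then obtain a b a' b' where *: "a \<in> P" "b \<in> carrier L - P" "W = \<phi> b \<union> (topspace T - \<phi> a)"
      "a' \<in> P" "b' \<in> carrier L - P" "W' = \<phi> b' \<union> (topspace T - \<phi> a')"
      by blast
    have "a \<sqinter> a' \<in> P" "b \<squnion> b' \<in> carrier L - P"
      using * PD(4) prime_filter_join_iff[OF P] by auto
    moreover have "\<phi> (b \<squnion> b') = \<phi> b \<union> \<phi> b'" "\<phi> (a \<sqinter> a') = \<phi> a \<inter> \<phi> a'"
      using * PD(1) by (auto simp: repr_join repr_meet subset_iff)
    ultimately show "\<exists>W''\<in>?\<U>. W \<union> W' \<subseteq> W''"
      using *
      by (intro bexI[of _ "\<phi> (b \<squnion> b') \<union> (topspace T - \<phi> (a \<sqinter> a'))"]) blast+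
  qed
  then obtain a b where ab: "a \<in> P" "b \<in> carrier L - P" "topspace T \<subseteq> \<phi> b \<union> (topspace T - \<phi> a)"
    by auto
  then have "\<phi> a \<subseteq> \<phi> b"
    using repr_points[of a] PD(1) by blast
  then have "a \<sqsubseteq> b"
    using ab PD(1) le_iff by auto
  then show False
    using PD(3)[of a b] ab by auto
qed

lemma point_prime_filter:
  assumes x: "x \<in> topspace T"
  shows "{a \<in> carrier L. x \<in> \<phi> a} \<in> prime_filters L"
  unfolding prime_filters_def
proof (intro CollectI conjI ballI impI)
  show "lattice_filter L {a \<in> carrier L. x \<in> \<phi> a}"
    using repr_filter[of "{x}"] x by simp
  have "\<bottom> \<notin> {a \<in> carrier L. x \<in> \<phi> a}"
    by (simp add: repr_bottom)
  then show "{a \<in> carrier L. x \<in> \<phi> a} \<noteq> carrier L"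
    by (metis bottom_closed)
qed (auto simp: repr_join)

end

locale esakia_representation =
  heyting_algebra H + esakia X + clopen_representation H "topol X" "clopen_upsets X" \<phi>
  for H :: "('a, 'b) heyting_scheme" (structure) and X :: "('x, 'c) ordered_space_scheme" and \<phi>
begin

text \<open>Residuation determines implication: the element representing the right-hand side has the
  same elements below it as \<open>imp H a b\<close>.\<close>

lemma repr_imp:
  assumes a: "a \<in> carrier H" and b: "b \<in> carrier H"
  shows "\<phi> (imp H a b) = points X - downset_of X (\<phi> a - \<phi> b)" (is "_ = ?I")
proof -
  obtain c where c: "c \<in> carrier H" "\<phi> c = ?I"
    using repr_surj clopen_upset_imp repr_closed a b by metis
  have *: "z \<sqsubseteq> c \<longleftrightarrow> z \<sqsubseteq> imp H a b" if "z \<in> carrier H" for z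
    using residuation[OF a b that] clopen_upset_residuation[OF repr_closed[OF that]]
      a b c that by (simp add: le_iff repr_meet)
  have "c = imp H a b"
    using *[of c] *[of "imp H a b"] imp_closed[OF a b] c(1) by (intro le_antisym) auto
  then show ?thesis using c by simp
qed

lemma repr_neg: "a \<in> carrier H \<Longrightarrow> \<phi> (neg H a) = points X - downset_of X (\<phi> a)"
  by (simp add: neg_def repr_imp repr_bottom)

text \<open>Clopen up-sets distinguish points, and compactness realizes every prime filter. This
  shows that the algebra of a dual pair is spectrally small.\<close>

lemma bij_betw_points_prime_filters: "bij_betw (\<lambda>x. {a \<in> carrier H. x \<in> \<phi> a}) (points X) (prime_filters H)"
  unfolding bij_betw_def
proof
  show "inj_on (\<lambda>x. {a \<in> carrier H. x \<in> \<phi> a}) (points X)"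
  proof (rule inj_onI)
    fix x y assume xy: "x \<in> points X" "y \<in> points X"
      "{a \<in> carrier H. x \<in> \<phi> a} = {a \<in> carrier H. y \<in> \<phi> a}"
    then have "x \<in> \<phi> a \<longleftrightarrow> y \<in> \<phi> a" if "a \<in> carrier H" for a
      using that by blast
    then show "x = y"
      using repr_surj by (intro point_eqI xy(1,2)) metis
  qed
  show "(\<lambda>x. {a \<in> carrier H. x \<in> \<phi> a}) ` points X = prime_filters H"
    using prime_filter_point[OF compact] point_prime_filter by blast
qed

end

text \<open>The functions \<open>eta1\<close> and \<open>eta2\<close> enter through
  \<open>box_eta\<close> and \<open>dia_eta\<close>. Nothing is lost at points of the space: their
  values consist of clopen up-sets and complements of such, and membership of these is what the two
  operators record.\<close>

locale mne_tw_dual = esakia_representation M X \<phi>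
  for M :: "'a modal_heyting" (structure) and X :: "'x mne_space" and \<phi> +
  fixes F :: "'a set"
  assumes mne: "mne_object X" and tw: "tw_object (M, F)"
    and repr_Box: "a \<in> carrier M \<Longrightarrow> \<phi> (Box M a) = box_eta X (\<phi> a)"
    and repr_Dia: "a \<in> carrier M \<Longrightarrow> \<phi> (Dia M a) = dia_eta X (\<phi> a)"
    and filter_eq: "F = {a \<in> carrier M. distinguished X \<subseteq> \<phi> a}"

sublocale mne_tw_dual \<subseteq> modal_heyting_algebra M
  using tw by (simp add: tw_object_def)

subsection \<open>The algebra of clopen up-sets\<close>

text \<open>The structure of the clopen up-sets is transported along a bijection with a given carrier.\<close>

definition clopen_algebra :: "'a set \<Rightarrow> ('a \<Rightarrow> 'x set) \<Rightarrow> 'x mne_space \<Rightarrow> 'a modal_heyting" where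
  "clopen_algebra A \<phi> X = \<lparr>carrier = A, eq = (=), le = (\<lambda>a b. \<phi> a \<subseteq> \<phi> b),
     imp = (\<lambda>a b. inv_into A \<phi> (points X - downset_of X (\<phi> a - \<phi> b))),
     Box = (\<lambda>a. inv_into A \<phi> (box_eta X (\<phi> a))), Dia = (\<lambda>a. inv_into A \<phi> (dia_eta X (\<phi> a)))\<rparr>"

text \<open>Clopen up-sets are closed under all the set operations involved, so every
  \<open>inv_into\<close> lands in \<open>A\<close> and \<open>\<phi>\<close> undoes it. Each law
  thereby becomes a statement about sets of points.\<close>

theorem clopen_algebra_dual:
  assumes X: "mne_object X" and bij: "bij_betw \<phi> A (clopen_upsets X)"
  shows "mne_tw_dual (clopen_algebra A \<phi> X) X \<phi> {a \<in> A. distinguished X \<subseteq> \<phi> a}"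
proof -
  let ?M = "clopen_algebra A \<phi> X" and ?F = "{a \<in> A. distinguished X \<subseteq> \<phi> a}"
  have ME: "modal_esakia_space X"
    using X by (simp add: mne_object_def)
  interpret esakia X
    using ME by unfold_locales (simp add: modal_esakia_space_def)
  have [simp]: "carrier ?M = A" "(.=\<^bsub>?M\<^esub>) = (=)" "a \<sqsubseteq>\<^bsub>?M\<^esub> b \<longleftrightarrow> \<phi> a \<subseteq> \<phi> b" for a b
    by (simp_all add: clopen_algebra_def)
  have inv: "inv_into A \<phi> U \<in> A" "\<phi> (inv_into A \<phi> U) = U" if "U \<in> clopen_upsets X" for U
    using that bij by (auto simp: bij_betw_def inv_into_into f_inv_into_f)
  have \<phi>: "\<phi> a \<in> clopen_upsets X" if "a \<in> A" for a
    using that bij by (auto simp: bij_betw_def)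
  have inj: "a = b" if "\<phi> a = \<phi> b" "a \<in> A" "b \<in> A" for a b
    using that bij by (auto simp: bij_betw_def inj_on_def)
  have Box_eta: "box_eta X (\<phi> a) \<in> clopen_upsets X" "dia_eta X (\<phi> a) \<in> clopen_upsets X"
    if "a \<in> A" for a
    using ME \<phi>[OF that] by (simp_all add: modal_esakia_space_def)
  interpret bounded_lattice ?M
  proof unfold_locales
    fix x y assume xy: "x \<in> carrier ?M" "y \<in> carrier ?M"
    let ?j = "inv_into A \<phi> (\<phi> x \<union> \<phi> y)" and ?m = "inv_into A \<phi> (\<phi> x \<inter> \<phi> y)"
    have "?j \<in> A" "\<phi> ?j = \<phi> x \<union> \<phi> y" "?m \<in> A" "\<phi> ?m = \<phi> x \<inter> \<phi> y"
      using xy inv \<phi> Un Int by simp_all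
    then have "least ?M ?j (Upper ?M {x, y})" "greatest ?M ?m (Lower ?M {x, y})"
      using xy by (auto simp: least_def greatest_def Upper_def Lower_def)
    then show "\<exists>s. least ?M s (Upper ?M {x, y})" "\<exists>s. greatest ?M s (Lower ?M {x, y})"
      by blast+
  next
    have "least ?M (inv_into A \<phi> {}) (carrier ?M)"
      using inv[OF empty] by (simp add: least_def)
    then show "\<exists>x. least ?M x (carrier ?M)" by blast
    have "greatest ?M (inv_into A \<phi> (points X)) (carrier ?M)"
      using inv[OF whole] clopen_upsetsD(3)[OF \<phi>] by (auto simp: greatest_def)
    then show "\<exists>x. greatest ?M x (carrier ?M)" by blast
  qed (auto intro: inj)
  \<comment> \<open>So far meets and joins are only greatest lower and least upper bounds.
    Identifying them with intersections and unions makes residuation a statement about sets.\<close>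
  interpret clopen_representation ?M "topol X" "clopen_upsets X" \<phi>
    by unfold_locales (simp_all add: bij)
  have imp: "imp ?M a b \<in> A" "\<phi> (imp ?M a b) = points X - downset_of X (\<phi> a - \<phi> b)"
    if "a \<in> A" "b \<in> A" for a b
    using inv[OF clopen_upset_imp[OF \<phi> \<phi>, OF that]] by (simp_all add: clopen_algebra_def)
  interpret heyting_algebra ?M
  proof unfold_locales
    fix x y z assume "x \<in> carrier ?M" "y \<in> carrier ?M" "z \<in> carrier ?M"
    then show "z \<sqinter>\<^bsub>?M\<^esub> x \<sqsubseteq>\<^bsub>?M\<^esub> y \<longleftrightarrow> z \<sqsubseteq>\<^bsub>?M\<^esub> imp ?M x y"
      using clopen_upset_residuation[OF \<phi>[of z]] by (simp add: repr_meet imp)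
  qed (simp add: imp)
  interpret esakia_representation ?M X \<phi>
    by unfold_locales
  have Box: "Box ?M a \<in> A" "\<phi> (Box ?M a) = box_eta X (\<phi> a)"
    "Dia ?M a \<in> A" "\<phi> (Dia ?M a) = dia_eta X (\<phi> a)" if "a \<in> A" for a
    using inv Box_eta[OF that] by (simp_all add: clopen_algebra_def)
  interpret modal_heyting_algebra ?M
  proof unfold_locales
    fix a b assume ab: "a \<in> carrier ?M" "b \<in> carrier ?M"
    then have n: "neg ?M a \<in> A" "neg ?M a \<sqinter>\<^bsub>?M\<^esub> b \<in> A"
      using neg_closed[of a] meet_closed[of "neg ?M a" b] by auto
    have "x \<notin> dia_eta X (\<phi> (neg ?M a \<sqinter>\<^bsub>?M\<^esub> b))" if x: "x \<in> box_eta X (\<phi> a)" for x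
    proof -
      have "downset_of X (\<phi> a) \<union> (points X - \<phi> b) \<in> eta2 X x"
        using ME x \<phi> ab by (simp add: modal_esakia_space_def box_eta_def)
      moreover have "downset_of X (\<phi> a) \<subseteq> points X"
        using leq_points by (auto simp: downset_of_def)
      then have "points X - \<phi> (neg ?M a \<sqinter>\<^bsub>?M\<^esub> b) = downset_of X (\<phi> a) \<union> (points X - \<phi> b)"
        using ab n by (auto simp: repr_meet repr_neg)
      ultimately show ?thesis
        by (simp add: dia_eta_def)
    qed
    then have "\<phi> (Box ?M a \<sqinter>\<^bsub>?M\<^esub> Dia ?M (neg ?M a \<sqinter>\<^bsub>?M\<^esub> b)) = {}"
      using ab n by (auto simp: repr_meet Box)
    then show "Box ?M a \<sqinter>\<^bsub>?M\<^esub> Dia ?M (neg ?M a \<sqinter>\<^bsub>?M\<^esub> b) = \<bottom>\<^bsub>?M\<^esub>"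
      using ab n Box bottom_closed meet_closed by (intro inj) (auto simp: repr_bottom)
  qed (simp_all add: Box)
  have C: "distinguished X \<subseteq> max_points X" "distinguished X \<subseteq> points X"
    using X by (auto simp: mne_object_def max_points_def)
  have "boolean_filter ?M ?F"
    unfolding boolean_filter_def
  proof (intro conjI ballI impI)
    show "lattice_filter ?M ?F"
      using repr_filter[OF C(2)] by simp
    fix x assume x: "x \<in> carrier ?M" "neg ?M (neg ?M x) = \<top>\<^bsub>?M\<^esub>"
    then have "points X - downset_of X (points X - downset_of X (\<phi> x)) = points X"
      using repr_neg[of "neg ?M x"] repr_neg[of x] neg_closed[of x] by (simp add: repr_top)
    moreover have "D \<inter> points X \<subseteq> downset_of X D" for D
      using leq_refl by (auto simp: downset_of_def)
    \<comment> \<open>A set lies in its own down-set, so the complement of the down-set of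
      \<open>\<phi> x\<close> is empty. A distinguished point is therefore below a member of
      \<open>\<phi> x\<close> and, being maximal, equals it.\<close>
    ultimately have dense: "points X \<subseteq> downset_of X (\<phi> x)"
      by blast
    have "distinguished X \<subseteq> \<phi> x"
    proof
      fix z assume z: "z \<in> distinguished X"
      then obtain y where "y \<in> \<phi> x" "(z, y) \<in> leq X"
        using dense C(2) by (auto simp: downset_of_def)
      then show "z \<in> \<phi> x"
        using z C(1) by (auto simp: max_points_def)
    qed
    then show "x \<in> ?F"
      using x by simp
  qed
  moreover have "Box ?M a \<squnion>\<^bsub>?M\<^esub> Dia ?M b \<in> ?F"
    if "a \<in> A" "b \<in> A" "a \<sqinter>\<^bsub>?M\<^esub> b = \<bottom>\<^bsub>?M\<^esub>" "a \<squnion>\<^bsub>?M\<^esub> b \<in> ?F" for a b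
  proof -
    have "\<phi> a \<inter> \<phi> b = {}" "distinguished X \<subseteq> \<phi> a \<union> \<phi> b"
      using that repr_meet[of a b] repr_join[of a b] by (auto simp: repr_bottom)
    then have "distinguished X \<subseteq> box_eta X (\<phi> a) \<union> dia_eta X (\<phi> b)"
      using X \<phi> that by (simp add: mne_object_def)
    then show ?thesis
      using that Box join_closed[of "Box ?M a" "Dia ?M b"] by (simp add: repr_join)
  qed
  ultimately have "tw_object (?M, ?F)"
    using modal_heyting_algebra_axioms by (simp add: tw_object_def)
  then show ?thesis
    by unfold_locales (use X Box in simp_all)
qed

subsection \<open>The space of prime filters\<close>

locale prime_filter_space = modal_heyting_algebra M
  for M :: "'a modal_heyting" (structure) +
  fixes F :: "'a set" and S :: "'x set" and p :: "'x \<Rightarrow> 'a set"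
  assumes tw: "tw_object (M, F)" and p: "bij_betw p S (prime_filters M)"
begin

definition repr :: "'a \<Rightarrow> 'x set" where
  "repr a = {x \<in> S. a \<in> p x}"

definition subbase :: "'x set set" where
  "subbase = repr ` carrier M \<union> (\<lambda>a. S - repr a) ` carrier M"

text \<open>This is the shape to which Alexander's subbase theorem applies. Complements belong to
  the subbase so that each \<open>repr a\<close> becomes clopen, and \<open>relative_to S\<close>
  fixes the set of points.\<close>

definition top_space :: "'x topology" where
  "top_space = topology (arbitrary union_of (finite intersection_of (\<lambda>U. U \<in> subbase) relative_to S))"

text \<open>The functions are forced by the requirement that \<open>box_eta\<close> and
  \<open>dia_eta\<close> represent \<open>Box\<close> and \<open>Dia\<close>; the negation and the
  complement in \<open>eta2\<close> mirror those in \<open>dia_eta\<close>.\<close>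

definition space :: "'x mne_space" where
  "space = \<lparr>topol = top_space, leq = {(x, y) \<in> S \<times> S. p x \<subseteq> p y},
     eta1 = (\<lambda>x. {repr a | a. a \<in> carrier M \<and> Box M a \<in> p x}),
     eta2 = (\<lambda>x. {S - repr a | a. a \<in> carrier M \<and> Dia M a \<notin> p x}),
     distinguished = {x \<in> S. F \<subseteq> p x}\<rparr>"

section \<open>Representation of the algebra by sets of prime filters\<close>

lemma prime: "x \<in> S \<Longrightarrow> p x \<in> prime_filters M"
  using p by (auto simp: bij_betw_def)

lemma filt: "x \<in> S \<Longrightarrow> lattice_filter M (p x)"
  by (rule prime_filtersD(1)[OF prime])

lemma point_of_prime: "P \<in> prime_filters M \<Longrightarrow> \<exists>x\<in>S. p x = P"
  using bij_betw_imp_surj_on[OF p] by (metis imageE)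

lemma p_inj: "\<lbrakk>x \<in> S; y \<in> S; p x = p y\<rbrakk> \<Longrightarrow> x = y"
  using p by (auto simp: bij_betw_def inj_on_def)

lemma repr_sub: "repr a \<subseteq> S"
  by (auto simp: repr_def)

lemma prime_filter_space_meet:
  "\<lbrakk>a \<in> carrier M; b \<in> carrier M\<rbrakk> \<Longrightarrow> repr (a \<sqinter> b) = repr a \<inter> repr b"
  using filter_meet_iff[OF filt] by (auto simp: repr_def)

lemma prime_filter_space_join:
  "\<lbrakk>a \<in> carrier M; b \<in> carrier M\<rbrakk> \<Longrightarrow> repr (a \<squnion> b) = repr a \<union> repr b"
  using prime_filter_join_iff[OF prime] by (auto simp: repr_def)

lemma prime_filter_space_bottom: "repr \<bottom> = {}"
  using prime_filter_bottom[OF prime] by (auto simp: repr_def)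

lemma prime_filter_space_top: "repr \<top> = S"
  using filter_top[OF filt] by (auto simp: repr_def)

lemma principal_filter: "a \<in> carrier M \<Longrightarrow> lattice_filter M {z \<in> carrier M. a \<sqsubseteq> z}"
  unfolding lattice_filter_def by (auto intro: meet_le le_trans)

text \<open>If \<open>a\<close> is not below \<open>b\<close>, the principal filter of
  \<open>a\<close> omits \<open>b\<close> and extends to a prime filter omitting
  \<open>b\<close>.\<close>

lemma prime_filter_space_le_iff:
  assumes a: "a \<in> carrier M" and b: "b \<in> carrier M"
  shows "a \<sqsubseteq> b \<longleftrightarrow> repr a \<subseteq> repr b"
proof
  assume "a \<sqsubseteq> b"
  then show "repr a \<subseteq> repr b"
    using lattice_filterD(3)[OF filt _ b] by (auto simp: repr_def)
next
  assume sub: "repr a \<subseteq> repr b"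
  show "a \<sqsubseteq> b"
  proof (rule ccontr)
    assume "\<not> a \<sqsubseteq> b"
    then have nb: "b \<notin> {z \<in> carrier M. a \<sqsubseteq> z}"
      by simp
    obtain P where P: "P \<in> prime_filters M" "{z \<in> carrier M. a \<sqsubseteq> z} \<subseteq> P" "b \<notin> P"
      using prime_filter_separation[OF principal_filter[OF a] b nb] by blast
    obtain x where "x \<in> S" "p x = P"
      using point_of_prime[OF P(1)] by blast
    then show False
      using P a sub by (auto simp: repr_def)
  qed
qed

lemma repr_inj: "\<lbrakk>a \<in> carrier M; b \<in> carrier M; repr a = repr b\<rbrakk> \<Longrightarrow> a = b"
  by (rule le_antisym) (simp_all add: prime_filter_space_le_iff)

lemma topspace: "topspace top_space = S"
  by (simp add: top_space_def)

lemma openin_subbase_member: "U \<in> subbase \<Longrightarrow> openin top_space U"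
proof -
  assume U: "U \<in> subbase"
  then have "U \<subseteq> S"
    using repr_sub by (auto simp: subbase_def)
  then show ?thesis
    unfolding top_space_def openin_subbase using U
    by (intro arbitrary_union_of_inc relative_to_subset_inc finite_intersection_of_inc) auto
qed

lemma clopen_repr:
  assumes "a \<in> carrier M"
  shows "openin top_space (repr a) \<and> closedin top_space (repr a)"
proof -
  have "openin top_space (repr a)" "openin top_space (S - repr a)"
    using assms by (auto intro!: openin_subbase_member simp: subbase_def)
  then show ?thesis
    using repr_sub by (simp add: closedin_def topspace)
qed

sublocale R: clopen_lattice top_space "repr ` carrier M"
proof
  show "{} \<in> repr ` carrier M"
    using prime_filter_space_bottom bottom_closed by (metis imageI)
  show "topspace top_space \<in> repr ` carrier M"
    using prime_filter_space_top top_closed topspace by (metis imageI)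
  fix U V assume "U \<in> repr ` carrier M" "V \<in> repr ` carrier M"
  then obtain a b where ab: "a \<in> carrier M" "b \<in> carrier M" "U = repr a" "V = repr b"
    by blast
  show "U \<inter> V \<in> repr ` carrier M"
    using ab by (intro image_eqI[of _ _ "a \<sqinter> b"]) (simp_all add: prime_filter_space_meet)
  show "U \<union> V \<in> repr ` carrier M"
    using ab by (intro image_eqI[of _ _ "a \<squnion> b"]) (simp_all add: prime_filter_space_join)
qed (auto simp: clopen_repr)

text \<open>If a cover by subbasic sets had no finite subcover, the filter generated by the elements
  whose complements occur in it would be disjoint from the ideal generated by the elements that
  occur in it; a prime filter between the two is not covered.\<close>

lemma compact_space: "compact_space top_space"
proof (rule Alexander_subbase_alt)
  have "repr \<top> \<in> subbase"
    using top_closed unfolding subbase_def by blast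
  then show "S \<subseteq> \<Union>subbase"
    using prime_filter_space_top by blast
  show "topology (arbitrary union_of (finite intersection_of (\<lambda>x. x \<in> subbase) relative_to S)) = top_space"
    by (simp add: top_space_def)
  fix \<C> assume \<C>: "\<C> \<subseteq> subbase" "S \<subseteq> \<Union>\<C>"
  define A where "A = {a \<in> carrier M. repr a \<in> \<C>}"
  define B where "B = {b \<in> carrier M. S - repr b \<in> \<C>}"
  \<comment> \<open>Bounds by finite meets and joins are expressed as inclusions of sets, which
    avoids iterating the operations. The factor \<open>S\<close> gives the empty intersection its
    proper value.\<close>
  define G where "G = {z \<in> carrier M. \<exists>B'. finite B' \<and> B' \<subseteq> B \<and> S \<inter> \<Inter>(repr ` B') \<subseteq> repr z}"
  define I where "I = {z \<in> carrier M. \<exists>A'. finite A' \<and> A' \<subseteq> A \<and> repr z \<subseteq> \<Union>(repr ` A')}"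
  have G: "lattice_filter M G"
    unfolding lattice_filter_def
  proof (intro conjI ballI impI)
    show "G \<subseteq> carrier M"
      by (auto simp: G_def)
    have "\<top> \<in> G"
      unfolding G_def by (auto simp: prime_filter_space_top)
    then show "G \<noteq> {}" by blast
  next
    fix x y assume xy: "x \<in> G" "y \<in> carrier M" "x \<sqsubseteq> y"
    then have "repr x \<subseteq> repr y"
      using prime_filter_space_le_iff[of x y] by (auto simp: G_def)
    then show "y \<in> G"
      using xy unfolding G_def by blast
  next
    fix x y assume "x \<in> G" "y \<in> G"
    then obtain B1 B2 where B12: "finite B1" "B1 \<subseteq> B" "S \<inter> \<Inter>(repr ` B1) \<subseteq> repr x"
      "finite B2" "B2 \<subseteq> B" "S \<inter> \<Inter>(repr ` B2) \<subseteq> repr y" "x \<in> carrier M" "y \<in> carrier M"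
      unfolding G_def by auto
    then have "S \<inter> \<Inter>(repr ` (B1 \<union> B2)) \<subseteq> repr (x \<sqinter> y)"
      by (auto simp: prime_filter_space_meet)
    then show "x \<sqinter> y \<in> G"
      using B12 unfolding G_def by (intro CollectI conjI exI[of _ "B1 \<union> B2"]) simp_all
  qed
  have I: "I \<subseteq> carrier M" "I \<noteq> {}"
  proof -
    have "\<bottom> \<in> I"
      unfolding I_def by (auto simp: prime_filter_space_bottom)
    then show "I \<noteq> {}" by blast
  qed (auto simp: I_def)
  have join: "x \<squnion> y \<in> I" if xy: "x \<in> I" "y \<in> I" for x y
  proof -
    obtain A1 A2 where A12: "finite A1" "A1 \<subseteq> A" "repr x \<subseteq> \<Union>(repr ` A1)"
      "finite A2" "A2 \<subseteq> A" "repr y \<subseteq> \<Union>(repr ` A2)" "x \<in> carrier M" "y \<in> carrier M"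
      using xy unfolding I_def by auto
    then have "repr (x \<squnion> y) \<subseteq> \<Union>(repr ` (A1 \<union> A2))"
      by (auto simp: prime_filter_space_join)
    then show ?thesis
      using A12 unfolding I_def by (intro CollectI conjI exI[of _ "A1 \<union> A2"]) simp_all
  qed
  have "G \<inter> I \<noteq> {}"
  proof
    assume "G \<inter> I = {}"
    then obtain P where P: "P \<in> prime_filters M" "G \<subseteq> P" "P \<inter> I = {}"
      using prime_filter_theorem[OF G I _ join] by blast
    obtain x where x: "x \<in> S" "p x = P"
      using point_of_prime[OF P(1)] by blast
    obtain U where U: "U \<in> \<C>" "x \<in> U"
      using \<C>(2) x by blast
    then consider a where "a \<in> A" "U = repr a" | b where "b \<in> B" "U = S - repr b"
      using \<C>(1) unfolding subbase_def A_def B_def by blast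
    then show False
    proof cases
      case 1
      then have "a \<in> I"
        unfolding I_def A_def by (auto intro!: exI[of _ "{a}"])
      then show False
        using 1 P(3) x U(2) by (auto simp: repr_def)
    next
      case 2
      then have "b \<in> G"
        unfolding G_def B_def by (auto intro!: exI[of _ "{b}"])
      then show False
        using 2 P(2) x U(2) by (auto simp: repr_def)
    qed
  qed
  then obtain z A' B' where z: "finite A'" "A' \<subseteq> A" "repr z \<subseteq> \<Union>(repr ` A')"
    "finite B'" "B' \<subseteq> B" "S \<inter> \<Inter>(repr ` B') \<subseteq> repr z"
    unfolding G_def I_def by blast
  \<comment> \<open>The set of \<open>z\<close> lies between the finite intersection and the finite
    union, so a point outside the intersection is covered by a complement and every other point by
    the union.\<close>
  let ?C = "repr ` A' \<union> (\<lambda>b. S - repr b) ` B'"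
  have "finite ?C" "?C \<subseteq> \<C>"
    using z by (auto simp: A_def B_def)
  moreover have "S \<subseteq> \<Union>?C"
  proof
    fix x assume x: "x \<in> S"
    then have "x \<in> \<Union>(repr ` A') \<or> x \<notin> \<Inter>(repr ` B')"
      using subsetD[OF z(3)] subsetD[OF z(6)] by blast
    then show "x \<in> \<Union>?C"
      using x by auto
  qed
  ultimately show "\<exists>\<C>'. finite \<C>' \<and> \<C>' \<subseteq> \<C> \<and> S \<subseteq> \<Union>\<C>'"
    by (intro exI[of _ ?C]) simp
qed

section \<open>Clopen up-sets of the spectrum and the Esakia condition\<close>

lemma space_simps [simp]:
  "topol space = top_space" "leq space = {(x, y) \<in> S \<times> S. p x \<subseteq> p y}"
  "eta1 space x = {repr a | a. a \<in> carrier M \<and> Box M a \<in> p x}"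
  "eta2 space x = {S - repr a | a. a \<in> carrier M \<and> Dia M a \<notin> p x}"
  "distinguished space = {x \<in> S. F \<subseteq> p x}"
  by (simp_all add: space_def)

lemma repr_separation:
  assumes "x \<in> S" "\<not> p x \<subseteq> p y"
  shows "\<exists>U\<in>repr ` carrier M. x \<in> U \<and> y \<notin> U"
proof -
  obtain a where "a \<in> p x" "a \<notin> p y"
    using assms(2) by blast
  moreover have "a \<in> carrier M"
    using lattice_filterD(1)[OF filt[OF assms(1)]] \<open>a \<in> p x\<close> by blast
  ultimately show ?thesis
    using assms(1) by (intro bexI[of _ "repr a"]) (auto simp: repr_def)
qed

text \<open>A clopen up-set and its complement are both compact, and no point of the former is below
  a point of the latter. Separating them in the direction of the order gives one
  \<open>repr a\<close> that equals the up-set.\<close>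

lemma clopen_upsets_space: "clopen_upsets space = repr ` carrier M"
proof
  show "repr ` carrier M \<subseteq> clopen_upsets space"
    using clopen_repr by (auto intro!: clopen_upsetsI) (auto simp: repr_def)
  show "clopen_upsets space \<subseteq> repr ` carrier M"
  proof
    fix U assume U: "U \<in> clopen_upsets space"
    note UD = clopen_upsetsD[OF U]
    have "\<exists>V\<in>repr ` carrier M. U \<subseteq> V \<and> (S - U) \<inter> V = {}"
    proof (rule R.separate_compact)
      show "compactin top_space U"
        using UD(2) closedin_compact_space[OF compact_space] by simp
      show "compactin top_space (S - U)"
        using UD(1) closedin_compact_space[OF compact_space] openin_closedin_eq[of top_space U]
        by (simp add: topspace)
      fix x y assume xy: "x \<in> U" "y \<in> S - U"
      then have "x \<in> S" "\<not> p x \<subseteq> p y"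
        using UD(3) UD(4)[of x y] by (auto simp: topspace)
      then show "\<exists>V\<in>repr ` carrier M. x \<in> V \<and> y \<notin> V"
        by (rule repr_separation)
    qed
    then obtain V where "V \<in> repr ` carrier M" "U \<subseteq> V" "(S - U) \<inter> V = {}"
      by blast
    moreover have "V \<subseteq> S"
      using \<open>V \<in> repr ` carrier M\<close> repr_sub by blast
    ultimately have "U = V"
      by blast
    then show "U \<in> repr ` carrier M"
      using \<open>V \<in> repr ` carrier M\<close> by simp
  qed
qed

text \<open>Here the prime filter theorem is applied to the filter generated by a prime filter
  without \<open>imp M a b\<close> and by \<open>a\<close>.\<close>

lemma downset_of_diff:
  assumes a: "a \<in> carrier M" and b: "b \<in> carrier M"
  shows "downset_of space (repr a - repr b) = S - repr (imp M a b)"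
proof (intro equalityI subsetI)
  fix x assume "x \<in> downset_of space (repr a - repr b)"
  then obtain y where y: "x \<in> S" "y \<in> S" "p x \<subseteq> p y" "a \<in> p y" "b \<notin> p y"
    by (auto simp: downset_of_def repr_def)
  have "imp M a b \<notin> p y"
  proof
    assume "imp M a b \<in> p y"
    then have "imp M a b \<sqinter> a \<in> p y"
      using y lattice_filterD(4)[OF filt[OF y(2)]] by blast
    then show False
      using lattice_filterD(3)[OF filt[OF y(2)] _ b imp_mp[OF a b]] y by blast
  qed
  then show "x \<in> S - repr (imp M a b)"
    using y by (auto simp: repr_def)
next
  fix x assume "x \<in> S - repr (imp M a b)"
  then have x: "x \<in> S" "imp M a b \<notin> p x"
    by (auto simp: repr_def)
  let ?G = "{z \<in> carrier M. \<exists>c\<in>p x. c \<sqinter> a \<sqsubseteq> z}"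
  have "b \<notin> ?G"
  proof
    assume "b \<in> ?G"
    then obtain c where c: "c \<in> p x" "c \<sqinter> a \<sqsubseteq> b"
      by blast
    moreover have "c \<in> carrier M"
      using c lattice_filterD(1)[OF filt[OF x(1)]] by blast
    ultimately have "c \<sqsubseteq> imp M a b"
      using residuation a b by blast
    then show False
      using lattice_filterD(3)[OF filt[OF x(1)] c(1) imp_closed[OF a b]] x by blast
  qed
  then obtain P where P: "P \<in> prime_filters M" "?G \<subseteq> P" "b \<notin> P"
    using prime_filter_separation[OF filter_adjoin(1)[OF filt[OF x(1)] a] b] by blast
  obtain y where y: "y \<in> S" "p y = P"
    using point_of_prime[OF P(1)] by blast
  have "insert a (p x) \<subseteq> p y"
    using subset_trans[OF filter_adjoin(2)[OF filt[OF x(1)] a] P(2)] y by simp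
  then show "x \<in> downset_of space (repr a - repr b)"
    using x y P(3) by (auto simp: downset_of_def repr_def)
qed

text \<open>Down-sets commute with unions, and those of the basic sets
  \<open>repr a - repr b\<close> are clopen because implication represents their complements. By
  compactness a clopen set is a finite union of basic sets, here expressed by a directed
  family.\<close>

lemma esakia_space_space: "esakia_space space"
  unfolding esakia_space_def
proof (intro conjI ballI impI)
  show "compact_space (topol space)"
    by (simp add: compact_space)
  show "partial_order_on (points space) (leq space)"
    using p_inj by (auto simp: partial_order_on_def preorder_on_def refl_on_def topspace
        intro!: transI antisymI)
  show "\<exists>U\<in>clopen_upsets space. x \<in> U \<and> y \<notin> U"
    if "x \<in> points space" "y \<in> points space" "(x, y) \<notin> leq space" for x y
    using that repr_separation[of x y] by (simp add: clopen_upsets_space topspace)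
  fix W assume W: "W \<in> clopens space"
  let ?\<U> = "{U. openin top_space U \<and> U \<subseteq> W \<and> downset_of space U \<in> clopens space}"
  have Un: "downset_of space (U \<union> V) = downset_of space U \<union> downset_of space V" for U V
    by (auto simp: downset_of_def)
  have "\<exists>U\<in>?\<U>. W \<subseteq> U"
  proof (rule compactin_directed_cover)
    show "compactin top_space W"
      using W closedin_compact_space[OF compact_space] by (simp add: clopens_def)
    have "{} \<in> ?\<U>"
      by (simp add: downset_of_def clopens_def)
    then show "?\<U> \<noteq> {}" by blast
    show "W \<subseteq> \<Union>?\<U>"
    proof
      fix x assume x: "x \<in> W"
      have Wo: "openin top_space W"
        using W by (simp add: clopens_def)
      have sep: "\<exists>U\<in>repr ` carrier M. (z \<in> U) \<noteq> (y \<in> U)"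
        if "z \<in> topspace top_space" "y \<in> topspace top_space" "z \<noteq> y" for z y
      proof (cases "p z \<subseteq> p y")
        case True
        then have "\<not> p y \<subseteq> p z"
          using p_inj[of z y] that by (auto simp: topspace)
        then show ?thesis
          using repr_separation[of y z] that by (auto simp: topspace)
      next
        case False
        then show ?thesis
          using repr_separation[of z y] that by (auto simp: topspace)
      qed
      obtain a b where ab: "a \<in> carrier M" "b \<in> carrier M" "x \<in> repr a - repr b" "repr a - repr b \<subseteq> W"
        using R.basis[OF compact_space sep Wo x] by auto
      have "downset_of space (repr a - repr b) \<in> clopens space"
        using clopen_repr[OF imp_closed[OF ab(1,2)]] openin_closedin_eq[of top_space "repr (imp M a b)"]
        by (simp add: downset_of_diff[OF ab(1,2)] clopens_def closedin_def topspace Diff_Diff_Int)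
      moreover have "openin top_space (repr a - repr b)"
        using clopen_repr ab by (simp add: openin_diff)
      ultimately have "repr a - repr b \<in> ?\<U>"
        using ab by simp
      then show "x \<in> \<Union>?\<U>"
        by (rule UnionI) (use ab in simp)
    qed
    show "\<exists>W'\<in>?\<U>. U \<union> V \<subseteq> W'" if "U \<in> ?\<U>" "V \<in> ?\<U>" for U V
      using that by (intro bexI[of _ "U \<union> V"]) (auto simp: Un clopens_def)
  qed blast
  then show "downset_of space W \<in> clopens space"
    by (auto dest: subset_antisym)
qed

text \<open>Membership in \<open>eta1\<close> asks for some representing element; as
  \<open>repr\<close> is injective, that element can only be \<open>a\<close>.\<close>

lemma box_eta_space: "a \<in> carrier M \<Longrightarrow> box_eta space (repr a) = repr (Box M a)"
  using repr_inj by (auto simp: box_eta_def topspace) (auto simp: repr_def)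

lemma dia_eta_space:
  assumes a: "a \<in> carrier M"
  shows "dia_eta space (repr a) = repr (Dia M a)"
proof -
  have "S - repr a \<in> {S - repr b | b. b \<in> carrier M \<and> Dia M b \<notin> p x} \<longleftrightarrow> Dia M a \<notin> p x" for x
  proof -
    have "b = a" if "b \<in> carrier M" "S - repr a = S - repr b" for b
      using that a repr_sub[of a] repr_sub[of b] by (intro repr_inj) blast+
    then show ?thesis
      using a by blast
  qed
  then show ?thesis
    by (auto simp: dia_eta_def topspace repr_def[of "Dia M a"])
qed

lemma esakia_representation_space: "esakia_representation M space repr"
proof -
  interpret esakia space
    by unfold_locales (rule esakia_space_space)
  interpret clopen_representation M "topol space" "clopen_upsets space" repr
  proof unfold_locales
    show "bij_betw repr (carrier M) (clopen_upsets space)"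
      using repr_inj by (auto simp: bij_betw_def clopen_upsets_space inj_on_def)
  qed (simp add: prime_filter_space_le_iff)
  show ?thesis
    by unfold_locales
qed

section \<open>The distinguished set of the spectrum\<close>

lemma filter_F: "lattice_filter M F"
  using tw by (simp add: tw_object_def boolean_filter_def)

text \<open>An element outside \<open>F\<close> is omitted by some prime filter above
  \<open>F\<close>, so the distinguished set remembers \<open>F\<close>.\<close>

lemma distinguished_sub_iff:
  assumes a: "a \<in> carrier M"
  shows "distinguished space \<subseteq> repr a \<longleftrightarrow> a \<in> F"
proof
  assume sub: "distinguished space \<subseteq> repr a"
  show "a \<in> F"
  proof (rule ccontr)
    assume "a \<notin> F"
    then obtain P where P: "P \<in> prime_filters M" "F \<subseteq> P" "a \<notin> P"
      using prime_filter_separation[OF filter_F a] by blast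
    obtain x where "x \<in> S" "p x = P"
      using point_of_prime[OF P(1)] by blast
    then show False
      using P sub by (auto simp: repr_def)
  qed
qed (auto simp: repr_def)

lemma mne_object_space: "mne_object space"
proof -
  interpret esakia_representation M space repr
    by (rule esakia_representation_space)
  have FM: "Box M a \<squnion> Dia M b \<in> F"
    if "a \<in> carrier M" "b \<in> carrier M" "a \<sqinter> b = \<bottom>" "a \<squnion> b \<in> F" for a b
    using tw that by (auto simp: tw_object_def)
  have FB: "boolean_filter M F"
    using tw by (simp add: tw_object_def)
  note F = filter_F and S_iff = distinguished_sub_iff
  have "modal_esakia_space space"
    unfolding modal_esakia_space_def
  proof (intro conjI ballI impI)
    show "esakia_space space"
      by (rule esakia_space_space)
    fix U assume "U \<in> clopen_upsets space"
    then obtain a where "a \<in> carrier M" "U = repr a"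
      by (auto simp: clopen_upsets_space)
    then show "box_eta space U \<in> clopen_upsets space" "dia_eta space U \<in> clopen_upsets space"
      by (simp_all add: box_eta_space dia_eta_space clopen_upsets_space Box_closed Dia_closed)
  next
    fix x assume "x \<in> points space"
    show "eta1 space x \<subseteq> clopen_upsets space"
      by (auto simp: clopen_upsets_space)
    show "eta2 space x \<subseteq> clopen_downsets space"
    proof
      fix D assume "D \<in> eta2 space x"
      then obtain a where "a \<in> carrier M" "D = S - repr a"
        by auto
      moreover from this have "openin top_space (topspace top_space - repr a)"
        "closedin top_space (topspace top_space - repr a)"
        using clopen_repr[of a] by (auto intro: openin_diff closedin_diff)
      moreover have "downset_of space (S - repr a) \<subseteq> S - repr a"
        by (auto simp: downset_of_def repr_def)
      ultimately show "D \<in> clopen_downsets space"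
        by (simp add: clopen_downsets_def clopens_def topspace)
    qed
  next
    fix x U V assume x: "x \<in> points space" and UV: "U \<in> clopen_upsets space" "V \<in> clopen_upsets space"
      and e: "U \<in> eta1 space x"
    obtain a b where ab: "a \<in> carrier M" "b \<in> carrier M" "U = repr a" "V = repr b"
      using UV by (auto simp: clopen_upsets_space)
    let ?c = "neg M a \<sqinter> b"
    have xS: "x \<in> S"
      using x by (simp add: topspace)
    have c: "neg M a \<in> carrier M" "?c \<in> carrier M"
      using ab by (simp_all add: neg_closed)
    have "x \<in> repr (Box M a)"
      using e x ab box_eta_space[OF ab(1)] by (auto simp: box_eta_def)
    moreover have "repr (Box M a) \<inter> repr (Dia M ?c) = {}"
      using Box_Dia[OF ab(1,2)] c ab
      by (simp add: Box_closed Dia_closed prime_filter_space_bottom flip: prime_filter_space_meet)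
    ultimately have "Dia M ?c \<notin> p x"
      using xS by (auto simp: repr_def)
    \<comment> \<open>The modal identity keeps \<open>Dia M ?c\<close> out of the prime filter of
      \<open>x\<close>; this puts the complement of \<open>repr ?c\<close>, the set required, into
      \<open>eta2\<close>.\<close>
    then have "S - repr ?c \<in> eta2 space x"
      using c by auto
    moreover have "downset_of space U \<subseteq> S"
      by (auto simp: downset_of_def)
    then have "S - repr ?c = downset_of space U \<union> (points space - V)"
      using ab c by (auto simp: prime_filter_space_meet repr_neg topspace)
    ultimately show "downset_of space U \<union> (points space - V) \<in> eta2 space x"
      by simp
  qed
  moreover have "closedin (topol space) (distinguished space)"
  proof -
    have "distinguished space = \<Inter>(repr ` F)"
      using lattice_filterD(2)[OF F] by (auto simp: repr_def)
    moreover have "closedin top_space (\<Inter>(repr ` F))"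
      using lattice_filterD(1,2)[OF F] clopen_repr by (intro closedin_Inter) auto
    ultimately show ?thesis by simp
  qed
  moreover have "distinguished space \<subseteq> max_points space"
  proof
    fix x assume "x \<in> distinguished space"
    then have x: "x \<in> S" "F \<subseteq> p x"
      by auto
    have "y = x" if y: "(x, y) \<in> leq space" for y
    proof -
      have yS: "y \<in> S" "p x \<subseteq> p y"
        using y by auto
      have "p y \<subseteq> p x"
      proof
        fix a assume a: "a \<in> p y"
        then have ac: "a \<in> carrier M"
          using lattice_filterD(1)[OF filt[OF yS(1)]] by blast
        have n: "neg M a \<in> carrier M"
          using ac by (rule neg_closed)
        \<comment> \<open>Primality then leaves \<open>a\<close> or its negation in
          \<open>p x\<close>, and the negation is incompatible with \<open>a\<close> in the larger
          filter \<open>p y\<close>.\<close>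
        have "a \<squnion> neg M a \<in> F"
          using FB neg_neg_excluded_middle[OF ac] ac n by (simp add: boolean_filter_def)
        then have "a \<in> p x \<or> neg M a \<in> p x"
          using x prime_filter_join_iff[OF prime[OF x(1)] ac n] by blast
        moreover have "neg M a \<notin> p x"
        proof
          assume "neg M a \<in> p x"
          then have "a \<sqinter> neg M a \<in> p y"
            using lattice_filterD(4)[OF filt[OF yS(1)] a] yS(2) by blast
          then show False
            using meet_neg[OF ac] prime_filter_bottom[OF prime[OF yS(1)]] by simp
        qed
        ultimately show "a \<in> p x" by simp
      qed
      then show ?thesis
        using p_inj[OF yS(1) x(1)] yS(2) by blast
    qed
    then show "x \<in> max_points space"
      using x by (simp add: max_points_def topspace)
  qed
  moreover have "distinguished space \<subseteq> box_eta space U \<union> dia_eta space V"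
    if U: "U \<in> clopen_upsets space" and V: "V \<in> clopen_upsets space"
      and UV: "distinguished space \<subseteq> U \<union> V" "U \<inter> V = {}" for U V
  proof -
    obtain a b where ab: "a \<in> carrier M" "b \<in> carrier M" "U = repr a" "V = repr b"
      using U V by (auto simp: clopen_upsets_space)
    have "repr (a \<sqinter> b) = repr \<bottom>"
      using ab UV(2) by (simp add: prime_filter_space_meet prime_filter_space_bottom)
    then have "a \<sqinter> b = \<bottom>"
      using ab by (intro repr_inj) auto
    moreover have "a \<squnion> b \<in> F"
      using ab UV(1) S_iff[of "a \<squnion> b"] by (simp add: prime_filter_space_join)
    ultimately have "Box M a \<squnion> Dia M b \<in> F"
      using FM ab by blast
    then show ?thesis
      using ab S_iff[of "Box M a \<squnion> Dia M b"]
      by (simp add: Box_closed Dia_closed prime_filter_space_join box_eta_space dia_eta_space)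
  qed
  ultimately show ?thesis
    by (simp add: mne_object_def)
qed

lemma dual_space: "mne_tw_dual M space repr F"
proof -
  interpret esakia_representation M space repr
    by (rule esakia_representation_space)
  show ?thesis
  proof unfold_locales
    show "mne_object space"
      by (rule mne_object_space)
    show "tw_object (M, F)"
      by (rule tw)
    show "F = {a \<in> carrier M. distinguished space \<subseteq> repr a}"
      using distinguished_sub_iff filter_F lattice_filterD(1) by blast
  qed (simp_all add: box_eta_space dia_eta_space)
qed

end

section \<open>Duality of morphisms\<close>

definition dual_maps ::
  "('a \<Rightarrow> 'x set) \<Rightarrow> 'x mne_space \<Rightarrow> ('b \<Rightarrow> 'y set) \<Rightarrow> 'b set \<Rightarrow> ('x \<Rightarrow> 'y) \<Rightarrow> ('b \<Rightarrow> 'a) \<Rightarrow> bool" where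
  "dual_maps \<phi> X \<psi> B f h \<longleftrightarrow> (\<forall>b\<in>B. \<phi> (h b) = preimage X f (\<psi> b))"

section \<open>Elementary properties of MNE-morphisms\<close>

lemma mne_morphismD:
  assumes "f \<in> mne_morphism X Y"
  shows "f \<in> extensional (points X)" "continuous_map (topol X) (topol Y) f"
    "\<And>x y. (x, y) \<in> leq X \<Longrightarrow> (f x, f y) \<in> leq Y"
    "\<And>x y. \<lbrakk>x \<in> points X; (f x, y) \<in> leq Y\<rbrakk> \<Longrightarrow> \<exists>z. (x, z) \<in> leq X \<and> f z = y"
    "\<And>x U. \<lbrakk>x \<in> points X; U \<in> clopen_upsets Y\<rbrakk> \<Longrightarrow> U \<in> eta1 Y (f x) \<longleftrightarrow> preimage X f U \<in> eta1 X x"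
    "\<And>x U. \<lbrakk>x \<in> points X; U \<in> clopen_upsets Y\<rbrakk>
      \<Longrightarrow> points Y - U \<in> eta2 Y (f x) \<longleftrightarrow> points X - preimage X f U \<in> eta2 X x"
    "f ` distinguished X \<subseteq> distinguished Y"
    "\<And>x. x \<in> points X \<Longrightarrow> f x \<in> points Y"
proof -
  show "\<exists>z. (x, z) \<in> leq X \<and> f z = y" if "x \<in> points X" "(f x, y) \<in> leq Y" for x y
  proof -
    have "y \<in> upset_of Y {f x}"
      using that by (simp add: upset_of_def)
    then have "y \<in> f ` upset_of X {x}"
      using assms that(1) by (auto simp: mne_morphism_def me_morphism_def)
    then show ?thesis
      by (auto simp: upset_of_def)
  qed
  show "f x \<in> points Y" if "x \<in> points X" for x
    using assms that continuous_map_image_subset_topspace[of "topol X" "topol Y" f]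
    by (auto simp: mne_morphism_def me_morphism_def)
qed (use assms in \<open>auto simp: mne_morphism_def me_morphism_def\<close>)

lemma preimage_clopen_upset:
  assumes leq: "leq X \<subseteq> points X \<times> points X"
    and f: "f \<in> mne_morphism X Y" and U: "U \<in> clopen_upsets Y"
  shows "preimage X f U \<in> clopen_upsets X"
proof (rule clopen_upsetsI)
  have eq: "preimage X f U = {x \<in> points X. f x \<in> U}"
    by (auto simp: preimage_def)
  note fD = mne_morphismD[OF f] and UD = clopen_upsetsD[OF U]
  show "openin (topol X) (preimage X f U)" "closedin (topol X) (preimage X f U)"
    unfolding eq
    using openin_continuous_map_preimage[OF fD(2) UD(1)] closedin_continuous_map_preimage[OF fD(2) UD(2)]
    by auto
  fix x y assume *: "x \<in> preimage X f U" "(x, y) \<in> leq X"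
  then have "f y \<in> U"
    using UD(4) fD(3) by (auto simp: preimage_def)
  moreover have "y \<in> points X" 
    using * leq by blast
  ultimately show "y \<in> preimage X f U"
    by (simp add: preimage_def)
qed

locale mne_tw_dual_pair = D1: mne_tw_dual M X \<phi> F + D2: mne_tw_dual N Y \<psi> G
  for M :: "'a modal_heyting" and X :: "'x mne_space" and \<phi> F
    and N :: "'b modal_heyting" and Y :: "'y mne_space" and \<psi> G
begin

text \<open>Preimages of clopen up-sets are again such, and each has exactly one representing
  element. So \<open>h\<close> can be read off, and every homomorphism law becomes an identity of
  preimages.\<close>

lemma dual_map_of_morphism:
  assumes f: "f \<in> mne_morphism X Y"
  shows "\<exists>h\<in>tw_hom (N, G) (M, F). dual_maps \<phi> X \<psi> (carrier N) f h"
proof -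
  note fD = mne_morphismD[OF f]
  have leqX: "leq X \<subseteq> points X \<times> points X"
    using D1.leq_points by auto
  have "\<exists>a\<in>carrier M. \<phi> a = preimage X f (\<psi> b)" if "b \<in> carrier N" for b
    using D1.repr_surj[OF preimage_clopen_upset[OF leqX f D2.repr_closed[OF that]]] .
  then obtain h' where h': "\<And>b. b \<in> carrier N \<Longrightarrow> h' b \<in> carrier M \<and> \<phi> (h' b) = preimage X f (\<psi> b)"
    by metis
  define h where "h = restrict h' (carrier N)"
  have h: "h b \<in> carrier M" "\<phi> (h b) = preimage X f (\<psi> b)" if "b \<in> carrier N" for b
    using h'[OF that] that by (auto simp: h_def)
  have eqI: "h b = a" if "b \<in> carrier N" "a \<in> carrier M" "\<phi> a = preimage X f (\<psi> b)" for a b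
    using D1.repr_eq_iff[of "h b" a] h[OF that(1)] that by simp
  \<comment> \<open>Taking preimages commutes with forming down-sets: one inclusion is the back
    condition on \<open>f\<close>, the other is monotonicity. Hence implication is
    preserved.\<close>
  have Im: "preimage X f (points Y - downset_of Y (U - V))
      = points X - downset_of X (preimage X f U - preimage X f V)" for U V
  proof -
    have "f x \<in> downset_of Y (U - V) \<longleftrightarrow> x \<in> downset_of X (preimage X f U - preimage X f V)"
      if x: "x \<in> points X" for x
    proof
      assume "f x \<in> downset_of Y (U - V)"
      then obtain y where y: "y \<in> U - V" "(f x, y) \<in> leq Y"
        by (auto simp: downset_of_def)
      then obtain z where "(x, z) \<in> leq X" "f z = y"
        using fD(4) x by blast
      then show "x \<in> downset_of X (preimage X f U - preimage X f V)"
        using y D1.leq_points by (auto simp: downset_of_def preimage_def)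
    next
      assume "x \<in> downset_of X (preimage X f U - preimage X f V)"
      then show "f x \<in> downset_of Y (U - V)"
        using fD(3) by (auto simp: downset_of_def preimage_def)
    qed
    then show ?thesis
      using fD(8) by (auto simp: preimage_def)
  qed
  have eta: "box_eta X (preimage X f U) = preimage X f (box_eta Y U)"
    "dia_eta X (preimage X f U) = preimage X f (dia_eta Y U)" if "U \<in> clopen_upsets Y" for U
    using that fD(5,6,8) by (auto simp: box_eta_def dia_eta_def preimage_def)
  have "h \<in> modal_heyting_hom N M"
    unfolding modal_heyting_hom_def
  proof (intro CollectI conjI ballI)
    show "h \<in> carrier N \<rightarrow>\<^sub>E carrier M"
      using h by (auto simp: h_def)
    show "h \<bottom>\<^bsub>N\<^esub> = \<bottom>\<^bsub>M\<^esub>"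
      by (rule eqI) (auto simp: D1.repr_bottom D2.repr_bottom preimage_def)
    show "h \<top>\<^bsub>N\<^esub> = \<top>\<^bsub>M\<^esub>"
      using fD(8) by (intro eqI) (auto simp: D1.repr_top D2.repr_top preimage_def)
  next
    fix x y assume xy: "x \<in> carrier N" "y \<in> carrier N"
    show "h (x \<sqinter>\<^bsub>N\<^esub> y) = h x \<sqinter>\<^bsub>M\<^esub> h y"
      using xy h by (intro eqI) (auto simp: D1.repr_meet D2.repr_meet preimage_def)
    show "h (x \<squnion>\<^bsub>N\<^esub> y) = h x \<squnion>\<^bsub>M\<^esub> h y"
      using xy h by (intro eqI) (auto simp: D1.repr_join D2.repr_join preimage_def)
    show "h (imp N x y) = imp M (h x) (h y)"
      using xy h by (intro eqI) (simp_all add: D1.imp_closed D2.imp_closed D1.repr_imp D2.repr_imp Im)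
  next
    fix x assume x: "x \<in> carrier N"
    show "h (Box N x) = Box M (h x)"
      using x h by (intro eqI)
        (simp_all add: D1.Box_closed D2.Box_closed D1.repr_Box D2.repr_Box eta D2.repr_closed)
    show "h (Dia N x) = Dia M (h x)"
      using x h by (intro eqI)
        (simp_all add: D1.Dia_closed D2.Dia_closed D1.repr_Dia D2.repr_Dia eta D2.repr_closed)
  qed
  moreover have "h ` G \<subseteq> F"
  proof -
    have "distinguished X \<subseteq> points X"
      using D1.mne closedin_subset by (auto simp: mne_object_def)
    then have "distinguished X \<subseteq> preimage X f (\<psi> b)" if "distinguished Y \<subseteq> \<psi> b" for b
      using that fD(7) unfolding preimage_def by blast
    then show ?thesis
      using h by (simp add: D1.filter_eq D2.filter_eq image_subset_iff)
  qed
  ultimately have "h \<in> tw_hom (N, G) (M, F)"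
    by (simp add: tw_hom_def)
  then show ?thesis
    using h by (auto simp: dual_maps_def)
qed

text \<open>\<open>f x\<close> is the point of \<open>Y\<close> whose prime filter is the inverse
  image under \<open>h\<close> of the prime filter of \<open>x\<close>; it exists by compactness of
  \<open>Y\<close>.\<close>

lemma dual_map_of_hom:
  assumes h: "h \<in> tw_hom (N, G) (M, F)"
  shows "\<exists>f\<in>mne_morphism X Y. dual_maps \<phi> X \<psi> (carrier N) f h"
proof -
  have hom: "h \<in> modal_heyting_hom N M" and hF: "h ` G \<subseteq> F"
    using h by (auto simp: tw_hom_def)
  have hc: "h b \<in> carrier M" if "b \<in> carrier N" for b
    using hom that by (auto simp: modal_heyting_hom_def)
  have h_bot: "h \<bottom>\<^bsub>N\<^esub> = \<bottom>\<^bsub>M\<^esub>" and h_top: "h \<top>\<^bsub>N\<^esub> = \<top>\<^bsub>M\<^esub>"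
    using hom by (auto simp: modal_heyting_hom_def)
  have h_op: "h (a \<sqinter>\<^bsub>N\<^esub> b) = h a \<sqinter>\<^bsub>M\<^esub> h b" "h (a \<squnion>\<^bsub>N\<^esub> b) = h a \<squnion>\<^bsub>M\<^esub> h b"
    "h (imp N a b) = imp M (h a) (h b)" "h (Box N a) = Box M (h a)" "h (Dia N a) = Dia M (h a)"
    if "a \<in> carrier N" "b \<in> carrier N" for a b
    using hom that by (auto simp: modal_heyting_hom_def)
  have "\<exists>y\<in>points Y. \<forall>b\<in>carrier N. y \<in> \<psi> b \<longleftrightarrow> x \<in> \<phi> (h b)" if x: "x \<in> points X" for x
  proof -
    let ?P = "{b \<in> carrier N. x \<in> \<phi> (h b)}"
    have mono: "x \<in> \<phi> (h b)" if "a \<in> carrier N" "b \<in> carrier N" "a \<sqsubseteq>\<^bsub>N\<^esub> b" "x \<in> \<phi> (h a)" for a b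
    proof -
      \<comment> \<open>Monotonicity of \<open>h\<close> is derived from preservation of
        meets.\<close>
      have "a = a \<sqinter>\<^bsub>N\<^esub> b"
        using D2.le_iff_join that by simp
      then have "\<phi> (h a) = \<phi> (h a) \<inter> \<phi> (h b)"
        using h_op(1)[of a b] that hc by (metis D1.repr_meet)
      then show ?thesis using that by blast
    qed
    have "?P \<in> prime_filters N"
      unfolding prime_filters_def lattice_filter_def
    proof (intro CollectI conjI ballI impI)
      have "\<top>\<^bsub>N\<^esub> \<in> ?P" "\<bottom>\<^bsub>N\<^esub> \<in> carrier N - ?P"
        using x by (simp_all add: h_top h_bot D1.repr_top D1.repr_bottom)
      then show "?P \<noteq> {}" "?P \<noteq> carrier N" by blast+
    qed (use mono hc in \<open>auto simp: h_op D1.repr_meet D1.repr_join\<close>)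
    then obtain y where "y \<in> points Y" "?P = {b \<in> carrier N. y \<in> \<psi> b}"
      using D2.prime_filter_point[OF D2.compact] by blast
    then show ?thesis by blast
  qed
  then obtain f' where f': "\<And>x. x \<in> points X \<Longrightarrow>
      f' x \<in> points Y \<and> (\<forall>b\<in>carrier N. f' x \<in> \<psi> b \<longleftrightarrow> x \<in> \<phi> (h b))"
    by metis
  define f where "f = restrict f' (points X)"
  have fp: "f x \<in> points Y" if "x \<in> points X" for x
    using f'[OF that] that by (simp add: f_def)
  have f: "f x \<in> \<psi> b \<longleftrightarrow> x \<in> \<phi> (h b)" if "x \<in> points X" "b \<in> carrier N" for x b
    using f'[OF that(1)] that by (simp add: f_def)
  have pre: "preimage X f (\<psi> b) = \<phi> (h b)" if "b \<in> carrier N" for b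
    using f[OF _ that] D1.repr_points[OF hc[OF that]] by (auto simp: preimage_def)
  have dual: "dual_maps \<phi> X \<psi> (carrier N) f h"
    by (simp add: dual_maps_def pre)
  have cont: "continuous_map (topol X) (topol Y) f"
    unfolding continuous_map_def
  proof (intro conjI allI impI)
    show "f \<in> points X \<rightarrow> points Y"
      using fp by blast
    fix W assume W: "openin (topol Y) W"
    show "openin (topol X) {x \<in> points X. f x \<in> W}"
    proof (subst openin_subopen, intro ballI)
      fix x assume x: "x \<in> {x \<in> points X. f x \<in> W}"
      \<comment> \<open>It suffices to consider basic neighbourhoods, whose preimages are
        differences of clopen sets.\<close>
      then obtain U V where UV: "U \<in> clopen_upsets Y" "V \<in> clopen_upsets Y" "f x \<in> U - V" "U - V \<subseteq> W"
        using D2.basis[OF D2.compact D2.point_separation W] by blast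
      then obtain a b where ab: "a \<in> carrier N" "b \<in> carrier N" "\<psi> a = U" "\<psi> b = V"
        using D2.repr_surj by metis
      have "openin (topol X) (\<phi> (h a) - \<phi> (h b))"
        using D1.clopen D1.repr_closed hc ab by (simp add: openin_diff)
      moreover have "x \<in> \<phi> (h a) - \<phi> (h b)"
        using x UV ab f by auto
      moreover have "\<phi> (h a) - \<phi> (h b) \<subseteq> {x \<in> points X. f x \<in> W}"
      proof
        fix z assume z: "z \<in> \<phi> (h a) - \<phi> (h b)"
        then have "z \<in> points X"
          using D1.repr_points[OF hc[OF ab(1)]] by blast
        then show "z \<in> {x \<in> points X. f x \<in> W}"
          using z f ab UV by auto
      qed
      ultimately show "\<exists>T. openin (topol X) T \<and> x \<in> T \<and> T \<subseteq> {x \<in> points X. f x \<in> W}"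
        by blast
    qed
  qed
  have mono: "(f x, f y) \<in> leq Y" if xy: "(x, y) \<in> leq X" for x y
  proof (rule D2.leqI)
    show "f x \<in> points Y" "f y \<in> points Y"
      using fp D1.leq_points[OF xy] by auto
    fix U assume U: "U \<in> clopen_upsets Y" "f x \<in> U"
    then obtain b where b: "b \<in> carrier N" "\<psi> b = U"
      using D2.repr_surj by blast
    then have "x \<in> \<phi> (h b)"
      using f U D1.leq_points[OF xy] by blast
    then have "y \<in> \<phi> (h b)"
      using clopen_upsetsD(4)[OF D1.repr_closed[OF hc[OF b(1)]]] xy by blast
    then show "f y \<in> U"
      using f b D1.leq_points[OF xy] by blast
  qed
  have up: "upset_of Y {f x} \<subseteq> f ` upset_of X {x}" if x: "x \<in> points X" for x
  proof
    fix y assume "y \<in> upset_of Y {f x}"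
    then have y: "(f x, y) \<in> leq Y" "y \<in> points Y"
      using D2.leq_points by (auto simp: upset_of_def)
    show "y \<in> f ` upset_of X {x}"
    proof (rule ccontr)
      assume ny: "y \<notin> f ` upset_of X {x}"
      have up_sub: "upset_of X {x} \<subseteq> points X"
        using D1.leq_points by (auto simp: upset_of_def)
      \<comment> \<open>As \<open>y\<close> lies outside this compact image, some basic set around
        \<open>y\<close> misses the image.\<close>
      have "compactin (topol Y) (f ` upset_of X {x})"
        using closedin_compact_space[OF D1.compact D1.closedin_upset_of[OF x]] cont
        by (rule image_compactin)
      moreover have "\<exists>U\<in>clopen_upsets Y. (z \<in> U) \<noteq> (y \<in> U)" if z: "z \<in> f ` upset_of X {x}" for z
        using D2.point_separation[of z y] y(2) ny z up_sub fp by auto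
      ultimately obtain U V where UV: "U \<in> clopen_upsets Y" "V \<in> clopen_upsets Y" "y \<in> U - V"
        "f ` upset_of X {x} \<inter> (U - V) = {}"
        using D2.separate_point_compact[of "f ` upset_of X {x}" y] y(2) by blast
      obtain a b where ab: "a \<in> carrier N" "b \<in> carrier N" "\<psi> a = U" "\<psi> b = V"
        using D2.repr_surj UV(1,2) by metis
      have "x \<notin> downset_of X (\<phi> (h a) - \<phi> (h b))"
      proof
        assume "x \<in> downset_of X (\<phi> (h a) - \<phi> (h b))"
        then obtain z where z: "(x, z) \<in> leq X" "z \<in> \<phi> (h a)" "z \<notin> \<phi> (h b)"
          by (auto simp: downset_of_def)
        then have "f z \<in> U - V"
          using f[of z a] f[of z b] ab D1.leq_points[of x z] by auto
        moreover have "f z \<in> f ` upset_of X {x}"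
          using z by (auto simp: upset_of_def)
        ultimately show False
          using UV(4) by blast
      qed
      \<comment> \<open>No point above \<open>x\<close> is sent into \<open>U - V\<close>, so
        \<open>x\<close> satisfies the implication. Since \<open>h\<close> preserves it, so does
        \<open>f x\<close>, although \<open>y\<close> lies above \<open>f x\<close> and in
        \<open>U - V\<close>.\<close>
      then have "x \<in> \<phi> (h (imp N a b))"
        using x ab hc by (simp add: h_op D1.repr_imp)
      then have "f x \<in> points Y - downset_of Y (U - V)"
        using f[OF x, of "imp N a b"] ab by (simp add: D2.imp_closed D2.repr_imp)
      then show False
        using y UV(3) by (auto simp: downset_of_def)
    qed
  qed
  have eta: "U \<in> eta1 Y (f x) \<longleftrightarrow> preimage X f U \<in> eta1 X x"
    "points Y - U \<in> eta2 Y (f x) \<longleftrightarrow> points X - preimage X f U \<in> eta2 X x"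
    if x: "x \<in> points X" and U: "U \<in> clopen_upsets Y" for x U
  proof -
    obtain b where b: "b \<in> carrier N" "\<psi> b = U"
      using D2.repr_surj U by blast
    \<comment> \<open>Both conditions on the neighbourhood functions are preservation of the
      operators, read at one point.\<close>
    have "f x \<in> box_eta Y U \<longleftrightarrow> x \<in> box_eta X (preimage X f U)"
      using f[OF x D2.Box_closed[OF b(1)]] D2.repr_Box[OF b(1)] D1.repr_Box[OF hc[OF b(1)]]
        h_op(4)[OF b(1) b(1)] pre[OF b(1)] b(2) by simp
    then show "U \<in> eta1 Y (f x) \<longleftrightarrow> preimage X f U \<in> eta1 X x"
      using x fp by (simp add: box_eta_def)
    have "f x \<in> dia_eta Y U \<longleftrightarrow> x \<in> dia_eta X (preimage X f U)"
      using f[OF x D2.Dia_closed[OF b(1)]] D2.repr_Dia[OF b(1)] D1.repr_Dia[OF hc[OF b(1)]]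
        h_op(5)[OF b(1) b(1)] pre[OF b(1)] b(2) by simp
    then show "points Y - U \<in> eta2 Y (f x) \<longleftrightarrow> points X - preimage X f U \<in> eta2 X x"
      using x fp by (simp add: dia_eta_def)
  qed
  have dist: "f ` distinguished X \<subseteq> distinguished Y"
  proof (rule image_subsetI, rule ccontr)
    fix x assume x: "x \<in> distinguished X" "f x \<notin> distinguished Y"
    have xp: "x \<in> points X"
      using x(1) D1.mne closedin_subset by (auto simp: mne_object_def)
    \<comment> \<open>Closedness and maximality of the distinguished set turn a point outside it
      into an element of \<open>G\<close> whose set omits the point.\<close>
    obtain U where U: "U \<in> clopen_upsets Y" "distinguished Y \<subseteq> U" "f x \<notin> U"
      using D2.closed_max_separation[of "distinguished Y" "f x"] D2.mne fp[OF xp] x(2)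
      by (auto simp: mne_object_def)
    then obtain b where b: "b \<in> carrier N" "\<psi> b = U"
      using D2.repr_surj by blast
    then have "h b \<in> F"
      using U hF by (auto simp: D2.filter_eq)
    then show False
      using x(1) f[OF xp b(1)] U(3) b(2) by (auto simp: D1.filter_eq)
  qed
  have "f \<in> mne_morphism X Y"
    using cont mono up eta dist by (simp add: mne_morphism_def me_morphism_def f_def)
  then show ?thesis
    using dual by blast
qed

lemma dual_maps_fun:
  assumes "h \<in> tw_hom (N, G) (M, F)" "h' \<in> tw_hom (N, G) (M, F)"
    and "dual_maps \<phi> X \<psi> (carrier N) f h" "dual_maps \<phi> X \<psi> (carrier N) f h'"
  shows "h = h'"
proof -
  have hs: "h \<in> carrier N \<rightarrow>\<^sub>E carrier M" "h' \<in> carrier N \<rightarrow>\<^sub>E carrier M"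
    using assms(1,2) by (auto simp: tw_hom_def modal_heyting_hom_def)
  then show ?thesis
  proof (rule PiE_ext)
    fix b assume b: "b \<in> carrier N"
    then have "\<phi> (h b) = \<phi> (h' b)"
      using assms(3,4) by (simp add: dual_maps_def)
    then show "h b = h' b"
      using D1.repr_eq_iff[of "h b" "h' b"] hs b by auto
  qed
qed

lemma dual_maps_inj:
  assumes f: "f \<in> mne_morphism X Y" and f': "f' \<in> mne_morphism X Y"
    and dual: "dual_maps \<phi> X \<psi> (carrier N) f h" "dual_maps \<phi> X \<psi> (carrier N) f' h"
  shows "f = f'"
proof (rule extensionalityI)
  fix x assume x: "x \<in> points X"
  show "f x = f' x"
  proof (rule D2.point_eqI)
    fix U assume "U \<in> clopen_upsets Y"
    then obtain b where b: "b \<in> carrier N" "\<psi> b = U"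
      using D2.repr_surj by blast
    then have "preimage X f U = preimage X f' U"
      using dual by (auto simp: dual_maps_def)
    then show "f x \<in> U \<longleftrightarrow> f' x \<in> U"
      using x by (auto simp: preimage_def)
  qed (use x mne_morphismD(8)[OF f] mne_morphismD(8)[OF f'] in auto)
qed (use mne_morphismD(1)[OF f] mne_morphismD(1)[OF f'] in auto)

end

section \<open>The categories\<close>

lemma category_op_cat:
  assumes "category C"
  shows "category (op_cat C)"
proof -
  interpret category C by fact
  show ?thesis
    by unfold_locales
      (simp_all add: op_cat_def ident_hom comp_hom comp_ident_right comp_ident_left comp_assoc)
qed

lemma category_full_subcat:
  assumes "category C"
  shows "category (full_subcat C P)"
proof -
  interpret category C by fact
  show ?thesis
    by unfold_locales
      (simp_all add: full_subcat_def ident_hom comp_hom comp_ident_right comp_ident_left comp_assoc)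
qed

section \<open>Composition and identities of homomorphisms\<close>

lemma tw_homD:
  assumes "h \<in> tw_hom (M, F) (N, G)"
  shows "h \<in> extensional (carrier M)" "h \<bottom>\<^bsub>M\<^esub> = \<bottom>\<^bsub>N\<^esub>" "h \<top>\<^bsub>M\<^esub> = \<top>\<^bsub>N\<^esub>"
    "\<And>x. x \<in> carrier M \<Longrightarrow> h x \<in> carrier N"
    "\<And>x y. \<lbrakk>x \<in> carrier M; y \<in> carrier M\<rbrakk> \<Longrightarrow> h (x \<sqinter>\<^bsub>M\<^esub> y) = h x \<sqinter>\<^bsub>N\<^esub> h y"
    "\<And>x y. \<lbrakk>x \<in> carrier M; y \<in> carrier M\<rbrakk> \<Longrightarrow> h (x \<squnion>\<^bsub>M\<^esub> y) = h x \<squnion>\<^bsub>N\<^esub> h y"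
    "\<And>x y. \<lbrakk>x \<in> carrier M; y \<in> carrier M\<rbrakk> \<Longrightarrow> h (imp M x y) = imp N (h x) (h y)"
    "\<And>x. x \<in> carrier M \<Longrightarrow> h (Box M x) = Box N (h x)"
    "\<And>x. x \<in> carrier M \<Longrightarrow> h (Dia M x) = Dia N (h x)"
    "\<And>x. x \<in> F \<Longrightarrow> h x \<in> G"
  using assms by (auto simp: tw_hom_def modal_heyting_hom_def PiE_def)

lemma tw_hom_comp:
  assumes M: "tw_object (M, F)" and h: "h \<in> tw_hom (M, F) (N, G)" and k: "k \<in> tw_hom (N, G) (P, K)"
  shows "compose (carrier M) k h \<in> tw_hom (M, F) (P, K)"
proof -
  interpret modal_heyting_algebra M
    using M by (simp add: tw_object_def)
  note hD = tw_homD[OF h] and kD = tw_homD[OF k]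
  have "F \<subseteq> carrier M"
    using M by (simp add: tw_object_def boolean_filter_def lattice_filter_def)
  then have "compose (carrier M) k h ` F \<subseteq> K"
    using hD(10) kD(10) by (auto simp: compose_def)
  moreover have "compose (carrier M) k h \<in> modal_heyting_hom M P"
    unfolding modal_heyting_hom_def
    by (intro CollectI conjI ballI)
      (simp_all add: compose_def PiE_def Pi_def hD kD imp_closed Box_closed Dia_closed)
  ultimately show ?thesis
    by (simp add: tw_hom_def)
qed

lemma tw_hom_ident:
  assumes M: "tw_object (M, F)"
  shows "restrict id (carrier M) \<in> tw_hom (M, F) (M, F)"
proof -
  interpret modal_heyting_algebra M
    using M by (simp add: tw_object_def)
  have "F \<subseteq> carrier M"
    using M by (simp add: tw_object_def boolean_filter_def lattice_filter_def)
  then have "restrict id (carrier M) ` F \<subseteq> F"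
    by auto
  moreover have "restrict id (carrier M) \<in> modal_heyting_hom M M"
    unfolding modal_heyting_hom_def
    by (intro CollectI conjI ballI) (simp_all add: imp_closed Box_closed Dia_closed)
  ultimately show ?thesis
    by (simp add: tw_hom_def)
qed

lemma category_TW: "category (TW \<A>)"
proof
  fix A assume "A \<in> Obj (TW \<A>)"
  then show "Ident (TW \<A>) A \<in> Hom (TW \<A>) A A"
    using tw_hom_ident[of "fst A" "snd A"] by (simp add: TW_def)
next
  fix A B C h k
  assume "A \<in> Obj (TW \<A>)" "h \<in> Hom (TW \<A>) A B" "k \<in> Hom (TW \<A>) B C"
  then show "Comp (TW \<A>) A B C k h \<in> Hom (TW \<A>) A C"
    using tw_hom_comp[of "fst A" "snd A" h "fst B" "snd B" k "fst C" "snd C"] by (simp add: TW_def)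
next
  fix A B h
  assume "h \<in> Hom (TW \<A>) A B"
  then have h: "h \<in> extensional (carrier (fst A))" "h \<in> carrier (fst A) \<rightarrow> carrier (fst B)"
    using tw_homD(1,4)[of h "fst A" "snd A" "fst B" "snd B"] by (auto simp: TW_def)
  show "Comp (TW \<A>) A A B h (Ident (TW \<A>) A) = h"
    using h(1) by (auto simp: TW_def compose_def extensional_def)
  show "Comp (TW \<A>) A B B (Ident (TW \<A>) B) h = h"
    using h by (auto simp: TW_def compose_def extensional_def fun_eq_iff Pi_def)
next
  fix A B C D h k l
  assume "h \<in> Hom (TW \<A>) A B"
  then have h: "h \<in> carrier (fst A) \<rightarrow> carrier (fst B)"
    using tw_homD(4)[of h "fst A" "snd A" "fst B" "snd B"] by (auto simp: TW_def)
  then show "Comp (TW \<A>) A C D l (Comp (TW \<A>) A B C k h)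
      = Comp (TW \<A>) A B D (Comp (TW \<A>) B C D l k) h"
    by (auto simp: TW_def compose_def fun_eq_iff Pi_def)
qed

section \<open>Composition and identities of MNE-morphisms\<close>

lemma mne_object_esakia: "mne_object X \<Longrightarrow> esakia X"
  by (simp add: mne_object_def modal_esakia_space_def esakia_def)

lemma preimage_compose:
  "(\<And>x. x \<in> points X \<Longrightarrow> f x \<in> points Y)
    \<Longrightarrow> preimage X (compose (points X) g f) U = preimage X f (preimage Y g U)"
  by (auto simp: preimage_def compose_def)

lemma mne_morphism_comp:
  assumes X: "mne_object X" and Y: "mne_object Y"
    and f: "f \<in> mne_morphism X Y" and g: "g \<in> mne_morphism Y Z"
  shows "compose (points X) g f \<in> mne_morphism X Z"
proof -
  interpret X: esakia X using X by (rule mne_object_esakia)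
  interpret Y: esakia Y using Y by (rule mne_object_esakia)
  note fD = mne_morphismD[OF f] and gD = mne_morphismD[OF g]
  have pre: "preimage X (compose (points X) g f) U = preimage X f (preimage Y g U)" for U
    using fD(8) by (rule preimage_compose)
  have cl: "preimage Y g U \<in> clopen_upsets Y" if "U \<in> clopen_upsets Z" for U
    using Y.leq_points by (intro preimage_clopen_upset[OF _ g that]) auto
  have "continuous_map (topol X) (topol Z) (compose (points X) g f)"
    by (rule continuous_map_eq[OF continuous_map_compose[OF fD(2) gD(2)]]) (simp add: compose_def)
  moreover have "(compose (points X) g f x, compose (points X) g f y) \<in> leq Z"
    if "(x, y) \<in> leq X" for x y
    using X.leq_points[OF that] gD(3)[OF fD(3)[OF that]] by (simp add: compose_def)
  moreover have "upset_of Z {compose (points X) g f x} \<subseteq> compose (points X) g f ` upset_of X {x}"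
    if x: "x \<in> points X" for x
  proof
    fix z assume "z \<in> upset_of Z {compose (points X) g f x}"
    then have "(g (f x), z) \<in> leq Z"
      using x by (simp add: upset_of_def compose_def)
    then obtain y where y: "(f x, y) \<in> leq Y" "g y = z"
      using gD(4)[OF fD(8)[OF x]] by blast
    then obtain w where w: "(x, w) \<in> leq X" "f w = y"
      using fD(4)[OF x] by blast
    then show "z \<in> compose (points X) g f ` upset_of X {x}"
      using y X.leq_points[OF w(1)]
      by (intro image_eqI[of _ _ w]) (auto simp: compose_def upset_of_def)
  qed
  moreover have "U \<in> eta1 Z (compose (points X) g f x)
        \<longleftrightarrow> preimage X (compose (points X) g f) U \<in> eta1 X x"
      "points Z - U \<in> eta2 Z (compose (points X) g f x)
        \<longleftrightarrow> points X - preimage X (compose (points X) g f) U \<in> eta2 X x"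
    if "x \<in> points X" "U \<in> clopen_upsets Z" for x U
    using that fD(5)[of x "preimage Y g U"] fD(6)[of x "preimage Y g U"] gD(5)[of "f x" U]
      gD(6)[of "f x" U] fD(8)[of x] cl[of U]
    unfolding pre by (simp_all add: compose_def)
  moreover have "compose (points X) g f ` distinguished X \<subseteq> distinguished Z"
  proof -
    have "distinguished X \<subseteq> points X"
      using X closedin_subset by (auto simp: mne_object_def)
    then show ?thesis
      using fD(7) gD(7) by (auto simp: compose_def)
  qed
  ultimately show ?thesis
    by (simp add: mne_morphism_def me_morphism_def)
qed

lemma mne_morphism_ident:
  assumes X: "mne_object X"
  shows "restrict id (points X) \<in> mne_morphism X X"
proof -
  interpret X: esakia X using X by (rule mne_object_esakia)
  have "continuous_map (topol X) (topol X) (restrict id (points X))"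
    by (rule continuous_map_eq[OF continuous_map_id]) simp
  moreover have "upset_of X {x} \<subseteq> restrict id (points X) ` upset_of X {x}" for x
    using X.leq_points by (auto simp: upset_of_def image_iff)
  moreover have "preimage X (restrict id (points X)) U = U" if "U \<in> clopen_upsets X" for U
    using clopen_upsetsD(3)[OF that] by (auto simp: preimage_def)
  moreover have "distinguished X \<subseteq> points X"
    using X closedin_subset by (auto simp: mne_object_def)
  ultimately show ?thesis
    using X.leq_points by (auto simp: mne_morphism_def me_morphism_def)
qed

lemma category_MNE: "category (MNE \<X>)"
proof
  fix X assume "X \<in> Obj (MNE \<X>)"
  then show "Ident (MNE \<X>) X \<in> Hom (MNE \<X>) X X"
    using mne_morphism_ident[of X] by (simp add: MNE_def)
next
  fix X Y Z f g
  assume "X \<in> Obj (MNE \<X>)" "Y \<in> Obj (MNE \<X>)" "f \<in> Hom (MNE \<X>) X Y" "g \<in> Hom (MNE \<X>) Y Z"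
  then show "Comp (MNE \<X>) X Y Z g f \<in> Hom (MNE \<X>) X Z"
    using mne_morphism_comp[of X Y f g Z] by (simp add: MNE_def)
next
  fix X Y f
  assume "f \<in> Hom (MNE \<X>) X Y"
  then have f: "f \<in> mne_morphism X Y"
    by (simp add: MNE_def)
  show "Comp (MNE \<X>) X X Y f (Ident (MNE \<X>) X) = f"
    using mne_morphismD(1)[OF f] by (auto simp: MNE_def compose_def extensional_def)
  show "Comp (MNE \<X>) X Y Y (Ident (MNE \<X>) Y) f = f"
    using mne_morphismD(1,8)[OF f] by (auto simp: MNE_def compose_def extensional_def)
next
  fix W X Y Z f g h
  assume "f \<in> Hom (MNE \<X>) W X"
  then have f: "f \<in> mne_morphism W X"
    by (simp add: MNE_def)
  show "Comp (MNE \<X>) W Y Z h (Comp (MNE \<X>) W X Y g f) = Comp (MNE \<X>) W X Z (Comp (MNE \<X>) X Y Z h g) f"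
    using mne_morphismD(8)[OF f] by (auto simp: MNE_def compose_def fun_eq_iff)
qed

section \<open>The dual equivalence\<close>

lemma mne_tw_dual_of_space:
  assumes "mne_object X" "clopen_upsets X \<approx> A"
  shows "\<exists>M F \<phi>. mne_tw_dual M X \<phi> F \<and> carrier M = A"
proof -
  obtain \<phi> where "bij_betw \<phi> A (clopen_upsets X)"
    using eqpoll_sym[OF assms(2)] by (auto simp: eqpoll_def)
  then show ?thesis
    using clopen_algebra_dual[OF assms(1)] by (fastforce simp: clopen_algebra_def)
qed

lemma mne_tw_dual_of_algebra:
  assumes "tw_object (M, F)" "prime_filters M \<approx> S"
  shows "\<exists>X \<phi>. mne_tw_dual M X \<phi> F \<and> points X = S"
proof -
  obtain p where p: "bij_betw p S (prime_filters M)"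
    using eqpoll_sym[OF assms(2)] by (auto simp: eqpoll_def)
  interpret modal_heyting_algebra M
    using assms(1) by (simp add: tw_object_def)
  interpret prime_filter_space M F S p
    by unfold_locales (fact assms(1), fact p)
  have "points space = S"
    by (simp add: topspace)
  then show ?thesis
    using dual_space by blast
qed

text \<open>The two carriers of a dual pair witness the two smallness conditions, so both ends of a
  dual triple lie in the full subcategories.\<close>

lemma mne_tw_dual_eqpoll:
  assumes "mne_tw_dual M X \<phi> F"
  shows "clopen_upsets X \<approx> carrier M" "prime_filters M \<approx> points X"
proof -
  interpret mne_tw_dual M X \<phi> F by fact
  show "clopen_upsets X \<approx> carrier M" "prime_filters M \<approx> points X"
    using bij bij_betw_points_prime_filters eqpoll_sym by (auto simp: eqpoll_def)
qed

definition dual_triples ::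
  "'a set set \<Rightarrow> 'x set set \<Rightarrow> ('x mne_space \<times> ('a modal_heyting \<times> 'a set) \<times> ('a \<Rightarrow> 'x set)) set" where
  "dual_triples \<A> \<X> = {(X, (M, F), \<phi>). mne_tw_dual M X \<phi> F \<and> carrier M \<in> \<A> \<and> points X \<in> \<X>}"

text \<open>A homomorphism runs against its dual map, hence \<open>op_cat\<close>, and the relation
  ranges over the carrier belonging to the target space. Smallness supplies the sets on which
  missing duals are built, so every object occurs in a triple.\<close>

lemma dual_correspondence_MNE_TW:
  "dual_correspondence (full_subcat (MNE \<X>) (clopen_small \<A>))
     (op_cat (full_subcat (TW \<A>) (spectrally_small \<X>)))
     (dual_triples \<A> \<X>) fst (\<lambda>t. fst (snd t))
     (\<lambda>(X, A, \<phi>) (Y, B, \<psi>). dual_maps \<phi> X \<psi> (carrier (fst B)))"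
  (is "dual_correspondence ?C ?D ?T ?L ?R ?Q")
proof -
  have Hom: "Hom ?C X Y = mne_morphism X Y" "Hom ?D A B = tw_hom B A" for X Y A B
    by (simp_all add: full_subcat_def op_cat_def MNE_def TW_def)
  have Comp: "Comp ?C X Y Z g f = compose (points X) g f"
    "Comp ?D A B C k h = compose (carrier (fst C)) h k" for X Y Z A B C f g h k
    by (simp_all add: full_subcat_def op_cat_def MNE_def TW_def)
  have Ident: "Ident ?C X = restrict id (points X)" "Ident ?D A = restrict id (carrier (fst A))" for X A
    by (simp_all add: full_subcat_def op_cat_def MNE_def TW_def)
  have Obj_C: "X \<in> Obj ?C \<longleftrightarrow> mne_object X \<and> points X \<in> \<X> \<and> (\<exists>A\<in>\<A>. clopen_upsets X \<approx> A)" for X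
    by (auto simp: full_subcat_def MNE_def clopen_small_def)
  have Obj_D: "(M, F) \<in> Obj ?D
      \<longleftrightarrow> tw_object (M, F) \<and> carrier M \<in> \<A> \<and> (\<exists>X\<in>\<X>. prime_filters M \<approx> X)" for M F
    by (auto simp: full_subcat_def op_cat_def TW_def spectrally_small_def)
  have T: "(X, (M, F), \<phi>) \<in> ?T \<longleftrightarrow> mne_tw_dual M X \<phi> F \<and> carrier M \<in> \<A> \<and> points X \<in> \<X>"
    for X M F \<phi>
    by (simp add: dual_triples_def)
  interpret C: category ?C
    by (intro category_full_subcat category_MNE)
  interpret D: category ?D
    by (intro category_op_cat category_full_subcat category_TW)
  show ?thesis
  proof
    fix t assume t: "t \<in> ?T"
    obtain X M F \<phi> where t_eq: "t = (X, (M, F), \<phi>)"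
      by (metis prod.collapse)
    have d: "mne_tw_dual M X \<phi> F" "carrier M \<in> \<A>" "points X \<in> \<X>"
      using t by (simp_all add: t_eq T)
    interpret mne_tw_dual M X \<phi> F by fact
    show "?L t \<in> Obj ?C" "?R t \<in> Obj ?D"
      using mne tw d mne_tw_dual_eqpoll[OF d(1)] by (auto simp: t_eq Obj_C Obj_D)
    have "\<phi> b = preimage X (restrict id (points X)) (\<phi> b)" if "b \<in> carrier M" for b
      using repr_points[OF that] by (auto simp: preimage_def)
    then show "?Q t t (Ident ?C (?L t)) (Ident ?D (?R t))"
      by (simp add: t_eq Ident dual_maps_def)
  next
    fix X assume "X \<in> Obj ?C"
    then obtain A where X: "mne_object X" "points X \<in> \<X>" "A \<in> \<A>" "clopen_upsets X \<approx> A"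
      by (auto simp: Obj_C)
    then obtain M F \<phi> where "(X, (M, F), \<phi>) \<in> ?T"
      using mne_tw_dual_of_space[OF X(1,4)] by (auto simp: T)
    then show "\<exists>t\<in>?T. ?L t = X"
      by force
  next
    fix A assume A: "A \<in> Obj ?D"
    obtain M F where A_eq: "A = (M, F)"
      by (cases A)
    obtain S where S: "tw_object (M, F)" "carrier M \<in> \<A>" "S \<in> \<X>" "prime_filters M \<approx> S"
      using A by (auto simp: A_eq Obj_D)
    then obtain X \<phi> where "(X, (M, F), \<phi>) \<in> ?T"
      using mne_tw_dual_of_algebra[OF S(1,4)] by (auto simp: T)
    then show "\<exists>t\<in>?T. ?R t = A"
      by (force simp: A_eq)
  next
    fix s t assume s: "s \<in> ?T" and t: "t \<in> ?T"
    obtain X M F \<phi> where s_eq: "s = (X, (M, F), \<phi>)"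
      by (metis prod.collapse)
    obtain Y N G \<psi> where t_eq: "t = (Y, (N, G), \<psi>)"
      by (metis prod.collapse)
    interpret mne_tw_dual_pair M X \<phi> F N Y \<psi> G
      using s t by (simp add: s_eq t_eq T mne_tw_dual_pair_def)
    note eqs = s_eq t_eq Hom
    show "\<exists>h\<in>Hom ?D (?R s) (?R t). ?Q s t f h" if "f \<in> Hom ?C (?L s) (?L t)" for f
      using dual_map_of_morphism that by (simp add: eqs)
    show "\<exists>f\<in>Hom ?C (?L s) (?L t). ?Q s t f h" if "h \<in> Hom ?D (?R s) (?R t)" for h
      using dual_map_of_hom that by (simp add: eqs)
    show "h = h'" if "h \<in> Hom ?D (?R s) (?R t)" "h' \<in> Hom ?D (?R s) (?R t)" "?Q s t f h" "?Q s t f h'"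
      for f h h'
      using dual_maps_fun[of h h' f] that by (simp add: eqs)
    show "f = f'" if "f \<in> Hom ?C (?L s) (?L t)" "f' \<in> Hom ?C (?L s) (?L t)" "?Q s t f h" "?Q s t f' h"
      for f f' h
      using dual_maps_inj[of f f' h] that by (simp add: eqs)
    fix u f g h k
    assume f: "f \<in> Hom ?C (?L s) (?L t)" and k: "k \<in> Hom ?D (?R t) (?R u)"
      and Q: "?Q s t f h" "?Q t u g k"
    obtain Z P K \<chi> where u_eq: "u = (Z, (P, K), \<chi>)"
      by (metis prod.collapse)
    have fY: "f x \<in> points Y" if "x \<in> points X" for x
      using mne_morphismD(8)[of f X Y] f that by (simp add: eqs)
    \<comment> \<open>The relation between \<open>f\<close> and \<open>h\<close> is assumed on the
      carrier of \<open>N\<close>, so it can be applied at \<open>k c\<close>.\<close>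
    have kN: "k c \<in> carrier N" if "c \<in> carrier P" for c
      using tw_homD(4)[of k P K N G] k that by (simp add: eqs u_eq)
    show "?Q s u (Comp ?C (?L s) (?L t) (?L u) g f) (Comp ?D (?R s) (?R t) (?R u) k h)"
      using Q kN preimage_compose[of X f Y g, OF fY]
      by (simp add: eqs u_eq Comp dual_maps_def compose_def[of "carrier P"])
  qed
qed

lemma full_subcat_all: "(\<And>X. X \<in> Obj C \<Longrightarrow> P X) \<Longrightarrow> full_subcat C P = C"
  by (cases C) (auto simp: full_subcat_def)

theorem theorem26:
  fixes \<A> :: "'a set set" and \<X> :: "'x set set"
  shows "dually_equivalent
           (full_subcat (MNE \<X>) (clopen_small \<A>))
           (full_subcat (TW \<A>) (spectrally_small \<X>))
       \<and> (powers_in \<A> \<X> \<and> powers_in \<X> \<A> \<longrightarrow> dually_equivalent (MNE \<X>) (TW \<A>))"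
proof -
  have "dually_equivalent (full_subcat (MNE \<X>) (clopen_small \<A>))
      (full_subcat (TW \<A>) (spectrally_small \<X>))"
    unfolding dually_equivalent_def
    by (rule dual_correspondence.equivalent_cats[OF dual_correspondence_MNE_TW])
  \<comment> \<open>Closure under subsets of power sets makes every object small, so nothing is lost
    by restricting to the full subcategories.\<close>
  moreover have "full_subcat (MNE \<X>) (clopen_small \<A>) = MNE \<X>"
    "full_subcat (TW \<A>) (spectrally_small \<X>) = TW \<A>" if "powers_in \<A> \<X>" "powers_in \<X> \<A>"
    using clopen_small_if_powers_in[OF that(2)] spectrally_small_if_powers_in[OF that(1)]
    by (simp_all add: full_subcat_all)
  ultimately show ?thesis
    by auto
qed

end
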